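(* Let $X$ be a non-empty topological space and let $\Sigma(X)$ be the (possibly empty) collection of all winning strategies for Alice in $\mathrm{RayGame}(X)$. Then the collection $\{\mathrm{succ}(\mathrm{dom}(\sigma)):\sigma\in\Sigma(X)\}$ comprises, up to isomorphism, the class of all pruned trees whose ray space is homeomorphic to $X$. That is: for every $\sigma\in\Sigma(X)$, $\mathrm{succ}(\mathrm{dom}(\sigma))$ is a pruned tree with $\mathcal R(\mathrm{succ}(\mathrm{dom}(\sigma)))$ homeomorphic to $X$; and every pruned tree $T$ with $\mathcal R(T)$ homeomorphic to $X$ is order-isomorphic to $\mathrm{succ}(\mathrm{dom}(\sigma))$ for some $\sigma\in\Sigma(X)$.
   Context: Trees. A tree is a partially ordered set $(T,\le)$ with a minimum (its root) such that $\lceil t\rceil=\{s\in T:s\le t\}$ is well-ordered for every $t\in T$. It is pruned if it has no maximal elements. A ray of $T$ is a non-empty downward closed chain of $T$ with no maximal element; the ray space $\mathcal R(T)$ is the set of all rays with the subspace topology inherited from the power set $\mathcal P(T)\simeq2^T$ (product topology). The game. A partition of a set is a pairwise disjoint collection of non-empty sets whose union is that set; an open partition is one whose members are open. For a non-empty space $X$, $\mathrm{RayGame}(X)$ is a transfinite game between Alice and Bob. In inning $0$, Alice chooses an open partition $\mathcal P_0$ of $X$ and Bob picks $U_0\in\mathcal P_0$. In a successor inning $\alpha=\beta+1$, Alice chooses an open partition $\mathcal P_{\beta+1}$ of $U_\beta$ and Bob picks $U_{\beta+1}\in\mathcal P_{\beta+1}$. In a (nonzero) limit inning $\alpha$: if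 there exist a pairwise disjoint collection $\mathcal P_\alpha$ of non-empty open sets and a point $x_\alpha\in X$ such that (1) $\bigcap_{\beta<\alpha}U_\beta=(\bigcup\mathcal P_\alpha)\sqcup\{x_\alpha\}$ (disjoint union) and (2) $\{U_\beta\setminus\bigcup\mathcal F:\beta<\alpha,\ \mathcal F\subset\mathcal P_\alpha\text{ finite}\}$ is a local basis at $x_\alpha$, then Alice chooses one such pair $(\mathcal P_\alpha,x_\alpha)$; if $\mathcal P_\alpha\ne\emptyset$, Bob picks $U_\alpha\in\mathcal P_\alpha$ and the game continues, while if $\mathcal P_\alpha=\emptyset$ the run ends and Alice wins. If no such pair exists, the run ends and Bob wins. Strategies. A strategy $\sigma$ for Alice is a recursively defined map assigning to each sequence $(U_\beta:\beta<\alpha)$ of Bob's moves made against $\sigma$ so far (including the empty sequence) a legal move of Alice in inning $\alpha$ whenever she has one; $\mathrm{dom}(\sigma)$ is the set of all such sequences. It is winning if every finished run in which Alice follows $\sigma$ is won by Alice. $\mathrm{succ}(\mathrm{dom}(\sigma))$ is the set consisting of the empty sequence and all sequences in $\mathrm{dom}(\sigma)$ whose length is a successor ordinal, ordered by inclusion (extension of sequences). *)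

theory Defs
  imports "HOL-Analysis.Analysis"
begin

section \<open>Trees and ray spaces\<close>

definition set_tree :: "'t set \<Rightarrow> 't rel \<Rightarrow> bool" where
  "set_tree T r \<longleftrightarrow>
     partial_order_on T r \<and>
     (\<exists>m\<in>T. \<forall>t\<in>T. (m, t) \<in> r) \<and>
     (\<forall>t\<in>T. well_order_on {s \<in> T. (s, t) \<in> r} (Restr r {s \<in> T. (s, t) \<in> r}))"

definition no_maximal :: "'t rel \<Rightarrow> 't set \<Rightarrow> bool" where
  "no_maximal r A \<longleftrightarrow> \<not> (\<exists>m\<in>A. \<forall>y\<in>A. (m, y) \<in> r \<longrightarrow> y = m)"

definition pruned_tree :: "'t set \<Rightarrow> 't rel \<Rightarrow> bool" where
  "pruned_tree T r \<longleftrightarrow> set_tree T r \<and> no_maximal r T"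

definition rays :: "'t set \<Rightarrow> 't rel \<Rightarrow> 't set set" where
  "rays T r = {R. R \<subseteq> T \<and> R \<noteq> {} \<and>
                  (\<forall>t\<in>R. \<forall>s\<in>T. (s, t) \<in> r \<longrightarrow> s \<in> R) \<and>
                  R \<in> Chains r \<and> no_maximal r R}"

text \<open>The product topology on \<open>2\<^sup>T\<close>, transported to the power set along the bijection sending a
  set to its characteristic function.\<close>
definition powerset_topology :: "'t set \<Rightarrow> 't set topology" where
  "powerset_topology T =
     pullback_topology (Pow T) (\<lambda>R. \<lambda>t\<in>T. t \<in> R)
       (product_topology (\<lambda>_. discrete_topology (UNIV :: bool set)) T)"

definition ray_space :: "'t set \<Rightarrow> 't rel \<Rightarrow> 't set topology" where
  "ray_space T r = subtopology (powerset_topology T) (rays T r)"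

definition order_isomorphic :: "'t set \<Rightarrow> 't rel \<Rightarrow> 'u set \<Rightarrow> 'u rel \<Rightarrow> bool" where
  "order_isomorphic T r S q \<longleftrightarrow>
     (\<exists>f. bij_betw f T S \<and> (\<forall>s\<in>T. \<forall>t\<in>T. (s, t) \<in> r \<longleftrightarrow> (f s, f t) \<in> q))"

section \<open>Innings\<close>

text \<open>The innings of a game on a space with points in \<open>'a\<close> are numbered by a type of order type
  \<open>\<kappa>\<^sup>+\<close>, where \<open>\<kappa> = max \<bar>'a\<bar> \<aleph>\<^sub>0\<close>.  This does not cut any play short: every limit inning that is
  passed removes a new point of the space, so no play passes through all innings of this type
  (proved as \<open>played_not_UNIV\<close> below).\<close>

typedef 'a inning = "Field (cardSuc (card_of (UNIV :: ('a + nat) set)))"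
proof -
  have "infinite (Field (cardSuc (card_of (UNIV :: ('a + nat) set)) ))"
    by (simp add: cardSuc_finite[OF card_of_Card_order] Field_card_of finite_Plus_UNIV_iff)
  then show ?thesis
    using infinite_imp_nonempty by blast
qed

instantiation inning :: (type) wellorder
begin

definition less_eq_inning :: "'a inning \<Rightarrow> 'a inning \<Rightarrow> bool" where
  "\<alpha> \<le> \<beta> \<longleftrightarrow> (Rep_inning \<alpha>, Rep_inning \<beta>) \<in> cardSuc (card_of (UNIV :: ('a + nat) set))"

definition less_inning :: "'a inning \<Rightarrow> 'a inning \<Rightarrow> bool" where
  "\<alpha> < \<beta> \<longleftrightarrow> \<alpha> \<le> \<beta> \<and> \<not> \<beta> \<le> (\<alpha> :: 'a inning)"

instance
proof -
  let ?r = "cardSuc (card_of (UNIV :: ('a + nat) set))"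
  have wo: "Well_order ?r"
    using cardSuc_Card_order[OF card_of_Card_order] card_order_on_well_order_on by blast
  then have refl: "refl_on (Field ?r) ?r" and tr: "trans ?r" and as: "antisym ?r"
    and tot: "total_on (Field ?r) ?r" and wf: "wf (?r - Id)"
    by (auto simp: well_order_on_def linear_order_on_def partial_order_on_def preorder_on_def)
  have le_refl: "\<alpha> \<le> \<alpha>" for \<alpha> :: "'a inning"
    using refl Rep_inning[of \<alpha>] by (simp add: less_eq_inning_def refl_on_def)
  have as': "\<alpha> = \<beta>" if "\<alpha> \<le> \<beta>" "\<beta> \<le> \<alpha>" for \<alpha> \<beta> :: "'a inning"
    using as that by (metis Rep_inning_inject antisymD less_eq_inning_def)
  have lt: "(\<beta> < \<alpha>) = ((Rep_inning \<beta>, Rep_inning \<alpha>) \<in> ?r - Id)" for \<alpha> \<beta> :: "'a inning"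
    using as' le_refl by (auto simp: less_inning_def less_eq_inning_def Rep_inning_inject)
  have wf': "wf {(\<beta>, \<alpha> :: 'a inning). \<beta> < \<alpha>}"
    using wf_inv_image[OF wf, of Rep_inning] by (simp add: inv_image_def lt)
  show "OFCLASS('a inning, wellorder_class)"
  proof
    fix \<alpha> \<beta> \<gamma> :: "'a inning"
    show "(\<alpha> < \<beta>) = (\<alpha> \<le> \<beta> \<and> \<not> \<beta> \<le> \<alpha>)" by (rule less_inning_def)
    show "\<alpha> \<le> \<alpha>" by (rule le_refl)
    show "\<alpha> \<le> \<gamma>" if "\<alpha> \<le> \<beta>" "\<beta> \<le> \<gamma>"
      using tr that unfolding less_eq_inning_def by (meson transD)
    show "\<alpha> = \<beta>" if "\<alpha> \<le> \<beta>" "\<beta> \<le> \<alpha>" using that by (rule as')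
    show "\<alpha> \<le> \<beta> \<or> \<beta> \<le> \<alpha>"
      using tot le_refl Rep_inning[of \<alpha>] Rep_inning[of \<beta>]
      by (metis Rep_inning_inject less_eq_inning_def total_on_def)
  next
    fix P :: "'a inning \<Rightarrow> bool" and \<alpha>
    assume "\<And>x. (\<And>y. y < x \<Longrightarrow> P y) \<Longrightarrow> P x"
    then show "P \<alpha>" using wf' by (rule_tac wf_induct_rule[OF wf']) auto
  qed
qed

end

section \<open>The ray game\<close>

text \<open>Alice offers either an open partition, or, in limit innings, a pair \<open>(P, x)\<close>.\<close>
datatype 'a move = Partition "'a set set" | Limit "'a set set" 'a

primrec offer :: "'a move \<Rightarrow> 'a set set" where
  "offer (Partition P) = P"
| "offer (Limit P x) = P"

text \<open>A sequence \<open>(U\<^sub>\<beta> : \<beta> < \<alpha>)\<close> is a partial map on an initial segment of the innings; extension of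
  sequences is \<^const>\<open>map_le\<close>.\<close>
type_synonym ('o, 'a) bob_seq = "'o \<Rightarrow> 'a set option"

type_synonym ('o, 'a) strategy = "('o, 'a) bob_seq \<Rightarrow> 'a move option"

definition is_seq :: "('o::wellorder, 'a) bob_seq \<Rightarrow> bool" where
  "is_seq u \<longleftrightarrow> (\<forall>\<beta>\<in>dom u. \<forall>\<gamma><\<beta>. \<gamma> \<in> dom u)"

definition open_partition :: "'a topology \<Rightarrow> 'a set \<Rightarrow> 'a set set \<Rightarrow> bool" where
  "open_partition X U P \<longleftrightarrow> partition_on U P \<and> (\<forall>V\<in>P. openin X V)"

definition local_basis_at :: "'a topology \<Rightarrow> 'a \<Rightarrow> 'a set set \<Rightarrow> bool" where
  "local_basis_at X x B \<longleftrightarrow>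
     (\<forall>V\<in>B. openin X V \<and> x \<in> V) \<and>
     (\<forall>W. openin X W \<and> x \<in> W \<longrightarrow> (\<exists>V\<in>B. V \<subseteq> W))"

definition limit_pair :: "'a topology \<Rightarrow> ('o::wellorder, 'a) bob_seq \<Rightarrow> 'a set set \<Rightarrow> 'a \<Rightarrow> bool" where
  "limit_pair X u P x \<longleftrightarrow>
     disjoint P \<and> {} \<notin> P \<and> (\<forall>V\<in>P. openin X V) \<and> x \<in> topspace X \<and>
     \<Inter>(ran u) = \<Union>P \<union> {x} \<and> x \<notin> \<Union>P \<and>
     local_basis_at X x {U - \<Union>F | U F. U \<in> ran u \<and> finite F \<and> F \<subseteq> P}"

definition legal_move :: "'a topology \<Rightarrow> ('o::wellorder, 'a) bob_seq \<Rightarrow> 'a move \<Rightarrow> bool" where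
  "legal_move X u m \<longleftrightarrow>
     (if u = Map.empty then \<exists>P. m = Partition P \<and> open_partition X (topspace X) P
      else if \<exists>\<beta>. dom u = {..\<beta>}
      then \<exists>P \<beta>. m = Partition P \<and> dom u = {..\<beta>} \<and> open_partition X (the (u \<beta>)) P
      else \<exists>P x. m = Limit P x \<and> limit_pair X u P x)"

text \<open>The sequences of moves Bob can have made so far when Alice follows \<open>\<sigma>\<close>.\<close>
definition played :: "('o::wellorder, 'a) strategy \<Rightarrow> ('o, 'a) bob_seq \<Rightarrow> bool" where
  "played \<sigma> u \<longleftrightarrow> is_seq u \<and>
     (\<forall>\<beta>\<in>dom u. \<exists>m. \<sigma> (u |` {..<\<beta>}) = Some m \<and> the (u \<beta>) \<in> offer m)"

definition alice_strategy :: "'a topology \<Rightarrow> ('o::wellorder, 'a) strategy \<Rightarrow> bool" where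
  "alice_strategy X \<sigma> \<longleftrightarrow>
     dom \<sigma> = {u. played \<sigma> u \<and> (\<exists>m. legal_move X u m)} \<and>
     (\<forall>u\<in>dom \<sigma>. legal_move X u (the (\<sigma> u)))"

text \<open>No play lasts through all of \<^typ>\<open>'a inning\<close>: the points \<open>x\<^sub>\<alpha>\<close> of the limit innings passed are distinct.\<close>
lemma played_not_UNIV:
  includes cardinal_syntax
  fixes u :: "('a inning, 'a) bob_seq"
  assumes st: "alice_strategy X \<sigma>" and pl: "played \<sigma> u"
  shows "dom u \<noteq> UNIV"
proof
  assume full: "dom u = UNIV"
  define L where "L = {\<gamma> :: 'a inning. \<forall>\<beta><\<gamma>. {..<\<gamma>} \<noteq> {..\<beta>}}"
  define z where "z = (LEAST \<gamma> :: 'a inning. True)"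
  have ex: "\<exists>x. x \<notin> the (u \<gamma>) \<and> (\<forall>\<beta><\<gamma>. x \<in> the (u \<beta>))" if "\<gamma> \<in> L" "\<gamma> \<noteq> z" for \<gamma>
  proof -
    let ?v = "u |` {..<\<gamma>}"
    have dv: "dom ?v = {..<\<gamma>}" using full by simp
    obtain m where m: "\<sigma> ?v = Some m" "the (u \<gamma>) \<in> offer m"
      using pl full unfolding played_def by blast
    have lm: "legal_move X ?v m"
      using st m(1) unfolding alice_strategy_def by (metis domI option.sel)
    have "z < \<gamma>" using \<open>\<gamma> \<noteq> z\<close> unfolding z_def by (metis Least_le le_less)
    then have ne: "?v \<noteq> Map.empty" using dv by (metis dom_empty empty_iff lessThan_iff)
    have nb: "\<nexists>\<beta>. dom ?v = {..\<beta>}"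
      using \<open>\<gamma> \<in> L\<close> dv unfolding L_def by (metis (mono_tags, lifting) atMost_iff lessThan_iff mem_Collect_eq order_refl)
    obtain P x where P: "m = Limit P x" "limit_pair X ?v P x"
      using lm ne nb unfolding legal_move_def by auto
    then have "x \<notin> the (u \<gamma>)" "x \<in> \<Inter>(ran ?v)"
      using m(2) unfolding limit_pair_def by auto
    moreover have "the (u \<beta>) \<in> ran ?v" if "\<beta> < \<gamma>" for \<beta>
    proof -
      obtain U where "u \<beta> = Some U" using full by blast
      then have "?v \<beta> = Some U" using that by simp
      then show ?thesis using \<open>u \<beta> = Some U\<close> ranI by fastforce
    qed
    ultimately show ?thesis by blast
  qed
  define p where "p = (\<lambda>\<gamma>. SOME x. x \<notin> the (u \<gamma>) \<and> (\<forall>\<beta><\<gamma>. x \<in> the (u \<beta>)))"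
  have p: "p \<gamma> \<notin> the (u \<gamma>)" "\<And>\<beta>. \<beta> < \<gamma> \<Longrightarrow> p \<gamma> \<in> the (u \<beta>)" if "\<gamma> \<in> L" "\<gamma> \<noteq> z" for \<gamma>
    using someI_ex[OF ex[OF that]] unfolding p_def by auto
  have "inj_on p (L - {z})"
    by (rule inj_onI) (metis DiffE insertI1 linorder_neqE p(1) p(2))
  then have "inj_on (\<lambda>\<gamma>. if \<gamma> = z then Inr (0::nat) else Inl (p \<gamma>)) L"
    by (auto simp: inj_on_def)
  then have cL: "|L| \<le>o |UNIV :: ('a + nat) set|"
    using card_of_ordLeq by blast
  define sc where "sc = (\<lambda>\<beta> :: 'a inning. LEAST \<delta>. \<beta> < \<delta>)"
  have "\<exists>n. \<exists>\<gamma>\<in>L. \<alpha> = (sc ^^ n) \<gamma>" for \<alpha>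
  proof (induction \<alpha> rule: less_induct)
    case (less \<alpha>)
    show ?case
    proof (cases "\<alpha> \<in> L")
      case True
      then show ?thesis by (intro exI[of _ 0]) auto
    next
      case False
      then obtain \<beta> where b: "\<beta> < \<alpha>" "{..<\<alpha>} = {..\<beta>}" unfolding L_def by blast
      have "sc \<beta> = \<alpha>" unfolding sc_def
      proof (rule Least_equality)
        show "\<And>y. \<beta> < y \<Longrightarrow> \<alpha> \<le> y" using b(2) by (metis atMost_iff lessThan_iff linorder_not_le)
      qed (rule b(1))
      then show ?thesis using less[OF b(1)] by (metis funpow.simps(2) comp_apply)
    qed
  qed
  then have "(\<lambda>(n, \<gamma>). (sc ^^ n) \<gamma>) ` ((UNIV :: nat set) \<times> L) = UNIV"
    by (auto simp: image_iff)
  then have "|UNIV :: 'a inning set| \<le>o |(UNIV :: nat set) \<times> L|"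
    by (metis card_of_image)
  also have "|(UNIV :: nat set) \<times> L| \<le>o |UNIV :: ('a + nat) set|"
  proof (rule card_of_Times_ordLeq_infinite_Field[OF _ _ _ card_of_Card_order], unfold Field_card_of)
    show "infinite (UNIV :: ('a + nat) set)" by (simp add: finite_Plus_UNIV_iff)
    show "|UNIV :: nat set| \<le>o |UNIV :: ('a + nat) set|"
      using card_of_ordLeq[of "UNIV :: nat set" "UNIV :: ('a + nat) set"]
      by (metis inj_Inr subset_UNIV)
  qed (rule cL)
  finally have le: "|UNIV :: 'a inning set| \<le>o |UNIV :: ('a + nat) set|" .
  let ?r = "cardSuc |UNIV :: ('a + nat) set|"
  have "|Field ?r| \<le>o |UNIV :: 'a inning set|"
    using card_of_image[of Rep_inning UNIV] type_definition.Rep_range[OF type_definition_inning] by metis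
  moreover have "?r =o |Field ?r|"
    using card_of_Field_ordIso[OF cardSuc_Card_order[OF card_of_Card_order]] ordIso_symmetric by blast
  ultimately have "?r \<le>o |UNIV :: ('a + nat) set|"
    using le by (meson ordIso_ordLeq_trans ordLeq_transitive)
  then show False
    using cardSuc_greater[OF card_of_Card_order] not_ordLess_ordLeq by blast
qed

text \<open>Runs end only in limit innings: Alice wins with an empty \<open>P\<close>, Bob wins when no pair exists. In
  the other innings she always has a move.\<close>
definition alice_wins :: "('o::wellorder, 'a) strategy \<Rightarrow> ('o, 'a) bob_seq \<Rightarrow> bool" where
  "alice_wins \<sigma> u \<longleftrightarrow> (\<exists>x. \<sigma> u = Some (Limit {} x))"

definition bob_wins :: "'a topology \<Rightarrow> ('o::wellorder, 'a) bob_seq \<Rightarrow> bool" where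
  "bob_wins X u \<longleftrightarrow> \<not> (\<exists>m. legal_move X u m)"

definition finished_run ::
  "'a topology \<Rightarrow> ('o::wellorder, 'a) strategy \<Rightarrow> ('o, 'a) bob_seq \<Rightarrow> bool" where
  "finished_run X \<sigma> u \<longleftrightarrow> played \<sigma> u \<and> (alice_wins \<sigma> u \<or> bob_wins X u)"

definition winning_strategy :: "'a topology \<Rightarrow> ('o::wellorder, 'a) strategy \<Rightarrow> bool" where
  "winning_strategy X \<sigma> \<longleftrightarrow>
     alice_strategy X \<sigma> \<and> (\<forall>u. finished_run X \<sigma> u \<longrightarrow> alice_wins \<sigma> u)"

definition winning_strategies :: "'a topology \<Rightarrow> ('a inning, 'a) strategy set" where
  "winning_strategies X = {\<sigma>. winning_strategy X \<sigma>}"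

definition succ_seqs :: "('o::wellorder, 'a) bob_seq set \<Rightarrow> ('o, 'a) bob_seq set" where
  "succ_seqs D = {Map.empty} \<union> {u \<in> D. \<exists>\<beta>. dom u = {..\<beta>}}"

definition ext_order :: "('o::wellorder, 'a) bob_seq set \<Rightarrow> ('o, 'a) bob_seq rel" where
  "ext_order S = {(u, v). u \<in> S \<and> v \<in> S \<and> u \<subseteq>\<^sub>m v}"

end

theory Submission
  imports Defs
begin

text \<open>A winning strategy lets every point \<open>x\<close> be tracked: Bob keeps choosing the set that contains \<open>x\<close>
  until a limit inning where Alice's point is \<open>x\<close> itself.  The successor-length sequences
  met on the way form the ray of \<open>x\<close>, and the limit rules say that the sets \<open>U\<^sub>\<beta> - \<Union>F\<close>, which are
  the basic open sets of the ray space at this ray, form a local basis at \<open>x\<close>.  Conversely, if the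
  points are the rays of a tree \<open>T\<close>, then Bob's moves climb a branch: Alice partitions the rays through
  the nodes \<open>C\<close> played so far according to the minimal nodes above \<open>C\<close>, and when \<open>C\<close> has limit length it
  is itself a ray, namely the point she offers.\<close>

section \<open>The topology of ray spaces\<close>

text \<open>Three obstacles shape the proof. Continuity of the map from points to rays needs Bob's
  sets to be closed as well as open; at a limit inning this comes from the local basis, since
  removing one offered set must leave a neighbourhood of Alice's point. Conversely, a finite
  condition on rays may forbid arbitrary nodes, while the limit rule removes only sets that Bob
  could pick next; so a forbidden node is replaced by the minimal node over the branch that lies
  below it, or by a branch node whose presence already rules it out. Finally, each position must
  have a next inning: \<open>played_not_UNIV\<close> gives every played sequence a domain
  \<open>{..<\<alpha>}\<close>, both for gluing a ray into one position and for showing that the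
  climb to a given node of \<open>T\<close> ends. The root corresponds to the empty sequence, and
  the node reached in inning \<beta> has as strict predecessors the root and the nodes of the
  earlier innings. Sequences of limit length carry no node: a node of limit height is the move made
  after them, which is why only successor lengths enter the tree.\<close>

lemma topspace_ray_space: "topspace (ray_space T r) = rays T r"
proof -
  have "topspace (powerset_topology T) = Pow T"
    by (auto simp: powerset_topology_def topspace_pullback_topology)
  then show ?thesis by (auto simp: ray_space_def rays_def)
qed

text \<open>Each factor has two points, so a basic product neighbourhood fixes membership for
  finitely many nodes: \<open>E\<close> collects the required ones, \<open>F\<close> the forbidden
  ones.\<close>

lemma openin_powerset_topology:
  "openin (powerset_topology T) W \<longleftrightarrow> W \<subseteq> Pow T \<and>
     (\<forall>R\<in>W. \<exists>E F. finite E \<and> finite F \<and> E \<subseteq> R \<and> F \<subseteq> T - R \<and>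
        (\<forall>R'\<subseteq>T. E \<subseteq> R' \<and> F \<inter> R' = {} \<longrightarrow> R' \<in> W))" (is "?L \<longleftrightarrow> ?R")
proof
  let ?c = "\<lambda>R. \<lambda>t\<in>T. t \<in> R"
  assume ?L
  then obtain U where U: "openin (product_topology (\<lambda>_. discrete_topology (UNIV :: bool set)) T) U"
    and W: "W = ?c -` U \<inter> Pow T"
    unfolding powerset_topology_def openin_pullback_topology by blast
  show ?R
  proof (intro conjI ballI)
    fix R assume R: "R \<in> W"
    then have "?c R \<in> U" "R \<subseteq> T" using W by auto
    then obtain V where V: "finite {i\<in>T. V i \<noteq> (UNIV :: bool set)}" "?c R \<in> Pi\<^sub>E T V" "Pi\<^sub>E T V \<subseteq> U"
      using U unfolding openin_product_topology_alt by fastforce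
    let ?I = "{i\<in>T. V i \<noteq> UNIV}"
    show "\<exists>E F. finite E \<and> finite F \<and> E \<subseteq> R \<and> F \<subseteq> T - R \<and>
        (\<forall>R'\<subseteq>T. E \<subseteq> R' \<and> F \<inter> R' = {} \<longrightarrow> R' \<in> W)"
    \<comment> \<open>The finitely many restricted coordinates split according to \<open>R\<close>.
      As \<open>V i\<close> contains the value of \<open>R\<close> at \<open>i\<close>, agreeing
      with \<open>R\<close> on them is enough to stay in the box.\<close>
    proof (rule exI[of _ "?I \<inter> R"], rule exI[of _ "?I - R"], intro conjI allI impI)
      fix R' assume R': "R' \<subseteq> T" "?I \<inter> R \<subseteq> R' \<and> (?I - R) \<inter> R' = {}"
      have c: "?c R' \<in> Pi\<^sub>E T V"
      proof (rule PiE_I)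
        fix i assume i: "i \<in> T"
        have "(i \<in> R) \<in> V i" using V(2) i by (auto simp: PiE_def Pi_def)
        moreover have "i \<in> R \<longleftrightarrow> i \<in> R'" if "V i \<noteq> UNIV" using R'(2) i that by blast
        ultimately show "?c R' i \<in> V i" using i by (cases "V i = UNIV") auto
      qed auto
      have "?c R' \<in> U" using V(3) c by (rule subsetD)
      then show "R' \<in> W" using W R'(1) by blast
    qed (use V(1) in auto)
  qed (use W in auto)
next
  let ?c = "\<lambda>R. \<lambda>t\<in>T. t \<in> R"
  let ?P = "product_topology (\<lambda>_. discrete_topology (UNIV :: bool set)) T"
  assume R: ?R
  have WT: "W \<subseteq> Pow T" using R by blast
  have inj: "R = R'" if "?c R = ?c R'" "R \<subseteq> T" "R' \<subseteq> T" for R R'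
  proof -
    have "t \<in> R \<longleftrightarrow> t \<in> R'" if "t \<in> T" for t
      using fun_cong[OF \<open>?c R = ?c R'\<close>, of t] that by simp
    then show ?thesis using that by blast
  qed
  have "openin ?P (?c ` W)"
    unfolding openin_product_topology_alt
  proof
    fix f assume "f \<in> ?c ` W"
    then obtain S where S: "S \<in> W" "f = ?c S" by blast
    then obtain E F where EF: "finite E" "finite F" "E \<subseteq> S" "F \<subseteq> T - S"
      "\<And>R'. R' \<subseteq> T \<Longrightarrow> E \<subseteq> R' \<Longrightarrow> F \<inter> R' = {} \<Longrightarrow> R' \<in> W"
      using R by meson
    have ST: "S \<subseteq> T" using S WT by blast
    define V where "V = (\<lambda>i. if i \<in> E then {True} else if i \<in> F then {False} else UNIV)"
    have "finite {i\<in>T. V i \<noteq> UNIV}"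
      by (rule finite_subset[of _ "E \<union> F"]) (auto simp: V_def EF split: if_splits)
    moreover have "f \<in> Pi\<^sub>E T V"
      using S EF(3,4) by (auto simp: V_def PiE_def extensional_def)
    moreover have "Pi\<^sub>E T V \<subseteq> ?c ` W"
    proof
      fix g assume g: "g \<in> Pi\<^sub>E T V"
      have gV: "g t \<in> V t" if "t \<in> T" for t using g that by (rule PiE_mem)
      have "{t\<in>T. g t} \<in> W"
      proof (rule EF(5))
        show "E \<subseteq> {t\<in>T. g t}" using gV EF(3) ST by (force simp: V_def)
        show "F \<inter> {t\<in>T. g t} = {}" using gV EF(3,4) by (force simp: V_def split: if_splits)
      qed auto
      moreover have "g = ?c {t\<in>T. g t}"
        using g by (auto simp: PiE_def extensional_def fun_eq_iff)
      ultimately show "g \<in> ?c ` W" by blast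
    qed
    ultimately show "\<exists>U. finite {i\<in>T. U i \<noteq> topspace (discrete_topology UNIV)} \<and>
        (\<forall>i\<in>T. openin (discrete_topology UNIV) (U i)) \<and> f \<in> Pi\<^sub>E T U \<and> Pi\<^sub>E T U \<subseteq> ?c ` W"
      by (intro exI[of _ V]) simp
  qed
  moreover have "W = ?c -` (?c ` W) \<inter> Pow T" using WT inj by blast
  ultimately show ?L unfolding powerset_topology_def openin_pullback_topology by blast
qed

lemma openin_ray_space:
  "openin (ray_space T r) W \<longleftrightarrow> W \<subseteq> rays T r \<and>
     (\<forall>R\<in>W. \<exists>E F. finite E \<and> finite F \<and> E \<subseteq> R \<and> F \<subseteq> T - R \<and>
        (\<forall>R'\<in>rays T r. E \<subseteq> R' \<and> F \<inter> R' = {} \<longrightarrow> R' \<in> W))" (is "?L \<longleftrightarrow> ?R")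
proof
  assume ?L
  then obtain V where V: "openin (powerset_topology T) V" "W = V \<inter> rays T r"
    by (auto simp: ray_space_def openin_subtopology)
  have RT: "R \<subseteq> T" if "R \<in> rays T r" for R using that by (auto simp: rays_def)
  have "\<exists>E F. finite E \<and> finite F \<and> E \<subseteq> R \<and> F \<subseteq> T - R \<and>
        (\<forall>R'\<in>rays T r. E \<subseteq> R' \<and> F \<inter> R' = {} \<longrightarrow> R' \<in> W)" if "R \<in> W" for R
  proof -
    have "R \<in> V" using that V(2) by blast
    then obtain E F where "finite E" "finite F" "E \<subseteq> R" "F \<subseteq> T - R"
      "\<forall>R'\<subseteq>T. E \<subseteq> R' \<and> F \<inter> R' = {} \<longrightarrow> R' \<in> V"
      using V(1) unfolding openin_powerset_topology by metis
    moreover from this RT have "R' \<in> W" if "R' \<in> rays T r" "E \<subseteq> R'" "F \<inter> R' = {}" for R'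
      using that V(2) by simp
    ultimately show ?thesis by metis
  qed
  then show ?R using V(2) by blast
next
  assume R: ?R
  define B where "B = (\<lambda>(E, F). {R'. R' \<subseteq> T \<and> E \<subseteq> R' \<and> F \<inter> R' = {}})"
  \<comment> \<open>\<open>K\<close> gathers the finite conditions whose rays all lie in
    \<open>W\<close>; the union of their cylinders is open in the power set and has trace exactly
    \<open>W\<close>.\<close>
  define K where "K = {(E, F). finite E \<and> finite F \<and> F \<subseteq> T \<and> B (E, F) \<inter> rays T r \<subseteq> W}"
  have "openin (powerset_topology T) (\<Union> (B ` K))"
  proof (intro openin_Union ballI)
    fix S assume "S \<in> B ` K"
    then obtain E F where EF: "S = B (E, F)" "finite E" "finite F" "F \<subseteq> T" by (auto simp: K_def)
    show "openin (powerset_topology T) S"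
      unfolding openin_powerset_topology EF(1)
    proof (intro conjI ballI)
      fix Q assume "Q \<in> B (E, F)"
      then show "\<exists>E' F'. finite E' \<and> finite F' \<and> E' \<subseteq> Q \<and> F' \<subseteq> T - Q \<and>
          (\<forall>R'\<subseteq>T. E' \<subseteq> R' \<and> F' \<inter> R' = {} \<longrightarrow> R' \<in> B (E, F))"
        using EF by (rule_tac x = E in exI, rule_tac x = F in exI) (auto simp: B_def)
    qed (auto simp: B_def)
  qed
  moreover have "W = \<Union> (B ` K) \<inter> rays T r"
  proof
    show "W \<subseteq> \<Union> (B ` K) \<inter> rays T r"
    proof
      fix Q assume Q: "Q \<in> W"
      then have Qr: "Q \<in> rays T r" using R by blast
      obtain E F where EF: "finite E" "finite F" "E \<subseteq> Q" "F \<subseteq> T - Q"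
        "\<forall>R'\<in>rays T r. E \<subseteq> R' \<and> F \<inter> R' = {} \<longrightarrow> R' \<in> W"
        using R Q by meson
      have "(E, F) \<in> K" using EF by (auto simp: K_def B_def)
      moreover have "Q \<in> B (E, F)" using EF Qr by (auto simp: B_def rays_def)
      ultimately show "Q \<in> \<Union> (B ` K) \<inter> rays T r" using Qr by blast
    qed
  qed (auto simp: K_def)
  ultimately show ?L by (auto simp: ray_space_def openin_subtopology)
qed

section \<open>Sequences\<close>

text \<open>The first missing inning bounds the domain; the second hypothesis excludes the one
  initial segment that has no such bound.\<close>

lemma is_seq_dom:
  assumes "is_seq u" "dom u \<noteq> UNIV"
  obtains \<alpha> where "dom u = {..<\<alpha>}"
proof
  let ?\<alpha> = "LEAST \<alpha>. \<alpha> \<notin> dom u"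
  have "\<exists>\<alpha>. \<alpha> \<notin> dom u" using assms(2) by blast
  then have "?\<alpha> \<notin> dom u" by (rule LeastI_ex)
  then have "\<beta> < ?\<alpha>" if "\<beta> \<in> dom u" for \<beta>
    using assms(1) that unfolding is_seq_def by (metis not_less_iff_gr_or_eq)
  moreover have "\<beta> \<in> dom u" if "\<beta> < ?\<alpha>" for \<beta> using that not_less_Least by blast
  ultimately show "dom u = {..<?\<alpha>}" by blast
qed

lemma is_seq_restrict:
  assumes "is_seq u"
  shows "is_seq (u |` {..<\<beta>})" "is_seq (u |` {..\<beta>})"
  unfolding is_seq_def dom_restrict
  using assms[unfolded is_seq_def]
  by (blast intro: less_trans order_less_le_trans less_imp_le)+

lemma initial_subset:
  assumes "is_seq u" "\<beta> \<in> dom u"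
  shows "{..<\<beta>} \<subseteq> dom u" "{..\<beta>} \<subseteq> dom u"
proof -
  have "\<gamma> \<in> dom u" if "\<gamma> \<le> \<beta>" for \<gamma>
    using assms that unfolding is_seq_def le_less by blast
  then show "{..<\<beta>} \<subseteq> dom u" "{..\<beta>} \<subseteq> dom u" by (blast intro: less_imp_le)+
qed

lemma dom_restrict_initial:
  assumes "is_seq u" "\<beta> \<in> dom u"
  shows "dom (u |` {..<\<beta>}) = {..<\<beta>}" "dom (u |` {..\<beta>}) = {..\<beta>}"
  using initial_subset[OF assms] by (simp_all add: Int_absorb1)

lemma restrict_restrict_less: "(\<gamma> :: 'o :: wellorder) < \<beta> \<Longrightarrow> u |` {..<\<beta>} |` {..<\<gamma>} = u |` {..<\<gamma>}"
  by (intro ext) (auto simp: restrict_map_def)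

lemma restrict_restrict_le: "(\<gamma> :: 'o :: wellorder) \<le> \<beta> \<Longrightarrow> u |` {..\<beta>} |` {..<\<gamma>} = u |` {..<\<gamma>}"
  by (intro ext) (auto simp: restrict_map_def)

lemma map_le_restrict: "u |` A \<subseteq>\<^sub>m u"
  by (auto simp: map_le_def)

lemma restrict_restrict_map_le:
  assumes "u \<subseteq>\<^sub>m v" "A \<subseteq> dom u"
  shows "u |` A = v |` A"
proof
  fix x show "(u |` A) x = (v |` A) x"
    using assms by (cases "x \<in> A") (auto simp: map_le_def restrict_map_def subset_iff)
qed

lemma map_le_eq_restrict: "u \<subseteq>\<^sub>m v \<Longrightarrow> u = v |` dom u"
  by (rule ext) (auto simp: restrict_map_def map_le_def domIff)

lemma is_seq_comparable:
  assumes "is_seq u" "is_seq v" "\<And>\<beta>. \<beta> \<in> dom u \<Longrightarrow> \<beta> \<in> dom v \<Longrightarrow> u \<beta> = v \<beta>"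
  shows "u \<subseteq>\<^sub>m v \<or> v \<subseteq>\<^sub>m u"
proof -
  have "dom u \<subseteq> dom v \<or> dom v \<subseteq> dom u"
    using assms(1,2) unfolding is_seq_def by (metis linorder_neqE subsetI)
  then show ?thesis using assms(3) unfolding map_le_def by (metis subsetD)
qed

lemma played_restrict:
  assumes "played \<sigma> u"
  shows "played \<sigma> (u |` {..<\<beta>})" "played \<sigma> (u |` {..\<beta>})"
proof -
  have u: "\<exists>m. \<sigma> (u |` {..<\<gamma>}) = Some m \<and> the (u \<gamma>) \<in> offer m" if "\<gamma> \<in> dom u" for \<gamma>
    using assms that unfolding played_def by blast
  have s: "is_seq u" using assms unfolding played_def by blast
  show "played \<sigma> (u |` {..<\<beta>})"
    unfolding played_def dom_restrict
  proof (intro conjI ballI is_seq_restrict s)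
    fix \<gamma> assume "\<gamma> \<in> dom u \<inter> {..<\<beta>}"
    then show "\<exists>m. \<sigma> (u |` {..<\<beta>} |` {..<\<gamma>}) = Some m \<and> the ((u |` {..<\<beta>}) \<gamma>) \<in> offer m"
      using u[of \<gamma>] restrict_restrict_less[of \<gamma> \<beta> u] by auto
  qed
  show "played \<sigma> (u |` {..\<beta>})"
    unfolding played_def dom_restrict
  proof (intro conjI ballI is_seq_restrict s)
    fix \<gamma> assume "\<gamma> \<in> dom u \<inter> {..\<beta>}"
    then show "\<exists>m. \<sigma> (u |` {..\<beta>} |` {..<\<gamma>}) = Some m \<and> the ((u |` {..\<beta>}) \<gamma>) \<in> offer m"
      using u[of \<gamma>] restrict_restrict_le[of \<gamma> \<beta> u] by auto
  qed
qed

lemma played_fun_upd: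
  assumes "played \<sigma> u" "dom u = {..<\<alpha>}" "\<sigma> u = Some m" "V \<in> offer m"
  shows "played \<sigma> (u(\<alpha> \<mapsto> V))"
  unfolding played_def
proof (intro conjI ballI)
  show "is_seq (u(\<alpha> \<mapsto> V))" using assms(2) unfolding is_seq_def by auto
  fix \<beta> assume b: "\<beta> \<in> dom (u(\<alpha> \<mapsto> V))"
  have r: "u(\<alpha> \<mapsto> V) |` {..<\<beta>} = u |` {..<\<beta>}" using b assms(2) by (auto simp: restrict_map_def fun_eq_iff)
  show "\<exists>m. \<sigma> (u(\<alpha> \<mapsto> V) |` {..<\<beta>}) = Some m \<and> the ((u(\<alpha> \<mapsto> V)) \<beta>) \<in> offer m"
  proof (cases "\<beta> = \<alpha>")
    case True
    have "u |` {..<\<alpha>} = u" using map_le_eq_restrict[of u u] assms(2) by simp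
    then show ?thesis using r True assms by auto
  next
    case False
    then have "\<beta> \<in> dom u" using b by auto
    then show ?thesis using False assms(1) unfolding r played_def by auto
  qed
qed

section \<open>The tree of a winning strategy\<close>

text \<open>Intersecting with \<open>topspace X\<close> gives the empty sequence the whole space,
  since an empty intersection is the universe of the type. One notion thus covers the set on which
  Alice moves in inning 0 and later.\<close>

definition core :: "'a topology \<Rightarrow> ('o, 'a) bob_seq \<Rightarrow> 'a set" where
  "core X u = topspace X \<inter> \<Inter>(ran u)"

locale winning_play =
  fixes X :: "'a topology" and \<sigma> :: "('a inning, 'a) strategy"
  assumes nonempty: "topspace X \<noteq> {}"
    and winning: "winning_strategy X \<sigma>"
begin

abbreviation "S \<equiv> succ_seqs (dom \<sigma>)"
abbreviation "r \<equiv> ext_order S"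

section \<open>Replies of a winning strategy and the nested sets of a play\<close>

lemma strategy: "alice_strategy X \<sigma>"
  using winning unfolding winning_strategy_def by blast

text \<open>Without a legal move the run would be finished, and winning would force
  \<open>alice_wins\<close>; but then \<open>u\<close> is in \<open>dom \<sigma>\<close>, where a
  legal move exists. So a winning strategy replies to every played sequence.\<close>

lemma move:
  assumes "played \<sigma> u"
  obtains m where "\<sigma> u = Some m" "legal_move X u m"
proof -
  have "\<exists>m. legal_move X u m"
  proof (rule ccontr)
    assume n: "\<nexists>m. legal_move X u m"
    then have "alice_wins \<sigma> u"
      using winning assms unfolding winning_strategy_def finished_run_def bob_wins_def by blast
    then have "u \<in> dom \<sigma>" unfolding alice_wins_def by blast
    then show False using strategy n unfolding alice_strategy_def by blast
  qed
  then have u: "u \<in> dom \<sigma>" using strategy assms unfolding alice_strategy_def by blast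
  then have "legal_move X u (the (\<sigma> u))" using strategy unfolding alice_strategy_def by blast
  then show thesis using that u by auto
qed

lemma dom_strategy: "dom \<sigma> = {u. played \<sigma> u}"
proof -
  have "dom \<sigma> = {u. played \<sigma> u \<and> (\<exists>m. legal_move X u m)}"
    using strategy unfolding alice_strategy_def by blast
  moreover have "\<exists>m. legal_move X u m" if "played \<sigma> u" for u using move[OF that] by blast
  ultimately show ?thesis by blast
qed

lemma S_iff: "u \<in> S \<longleftrightarrow> played \<sigma> u \<and> (u = Map.empty \<or> (\<exists>\<beta>. dom u = {..\<beta>}))"
proof -
  have "played \<sigma> Map.empty" by (simp add: played_def is_seq_def)
  then show ?thesis unfolding succ_seqs_def dom_strategy by blast
qed

lemma played_is_seq: "played \<sigma> u \<Longrightarrow> is_seq u"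
  unfolding played_def by blast

lemma played_initial:
  assumes "played \<sigma> u"
  obtains \<alpha> where "dom u = {..<\<alpha>}"
  using is_seq_dom[OF played_is_seq[OF assms] played_not_UNIV[OF strategy assms]] that by blast

lemma last_move:
  assumes "played \<sigma> u" "u \<beta> = Some U"
  obtains m where "\<sigma> (u |` {..<\<beta>}) = Some m" "legal_move X (u |` {..<\<beta>}) m" "U \<in> offer m"
  using assms move[OF played_restrict(1)[OF assms(1)], of \<beta>] unfolding played_def
  by (metis domI option.sel option.inject)

lemma legal_move_open: "legal_move X u m \<Longrightarrow> U \<in> offer m \<Longrightarrow> openin X U \<and> U \<noteq> {}"
  unfolding legal_move_def
  by (auto simp: open_partition_def partition_on_def limit_pair_def split: if_splits)

lemma played_open:
  assumes "played \<sigma> u" "u \<beta> = Some U"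
  shows "openin X U" "U \<noteq> {}" "U \<subseteq> topspace X"
  using last_move[OF assms] legal_move_open openin_subset by metis+

lemma decreasing:
  assumes "played \<sigma> u" "u \<beta> = Some U" "u \<gamma> = Some V" "\<beta> \<le> \<gamma>"
  shows "V \<subseteq> U"
  using assms(3,4)
proof (induction \<gamma> arbitrary: V rule: less_induct)
  case (less \<gamma>)
  let ?v = "u |` {..<\<gamma>}"
  show ?case
  proof (cases "\<beta> = \<gamma>")
    case False
    then have bg: "\<beta> < \<gamma>" using less by simp
    obtain m where m: "legal_move X ?v m" "V \<in> offer m" using last_move[OF assms(1) less(2)] by blast
    have vb: "?v \<beta> = Some U" using bg assms(2) by simp
    then have ne: "?v \<noteq> Map.empty" by auto
    show ?thesis
    proof (cases "\<exists>\<delta>. dom ?v = {..\<delta>}")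
      case True
      then obtain P \<delta> where P: "m = Partition P" "dom ?v = {..\<delta>}" "open_partition X (the (?v \<delta>)) P"
        using m ne unfolding legal_move_def by (auto split: if_splits)
      have "V \<subseteq> the (?v \<delta>)" using P m(2) by (auto simp: open_partition_def partition_on_def)
      moreover obtain W where W: "?v \<delta> = Some W" using P(2) by (metis atMost_iff domD order_refl)
      then have "\<delta> < \<gamma>" "u \<delta> = Some W" by (auto simp: restrict_map_def split: if_splits)
      moreover have "\<beta> \<le> \<delta>" using P(2) vb by (metis atMost_iff domI)
      ultimately show ?thesis using less.IH W by fastforce
    next
      case False
      then obtain P x where "m = Limit P x" "limit_pair X ?v P x"
        using m ne unfolding legal_move_def by (auto split: if_splits)
      moreover have "U \<in> ran ?v" using vb by (rule ranI)
      ultimately show ?thesis using m(2) by (auto simp: limit_pair_def)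
    qed
  qed (use less assms in auto)
qed

lemma core_last:
  assumes "played \<sigma> u" "dom u = {..\<beta>}" "u \<beta> = Some U"
  shows "core X u = U"
proof -
  have "U \<subseteq> W" if W: "W \<in> ran u" for W
  proof -
    obtain \<gamma> where g: "u \<gamma> = Some W" using W by (auto simp: ran_def)
    then have "\<gamma> \<le> \<beta>" using assms(2) by (metis atMost_iff domI)
    then show ?thesis using decreasing[OF assms(1) g assms(3)] by blast
  qed
  moreover have "U \<in> ran u" using assms(3) by (rule ranI)
  ultimately show ?thesis using played_open[OF assms(1,3)] unfolding core_def by blast
qed

text \<open>Inning 0 and successor innings merge into one case, because in both the core is what
  Alice partitions; only a limit inning leaves a point outside the offered sets.\<close>

lemma move_cases:
  assumes "played \<sigma> u"
  obtains (succ) P where "\<sigma> u = Some (Partition P)" "u = Map.empty \<or> (\<exists>\<beta>. dom u = {..\<beta>})"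
      "disjoint P" "{} \<notin> P" "\<And>V. V \<in> P \<Longrightarrow> openin X V" "core X u = \<Union>P"
  | (limit) P x where "\<sigma> u = Some (Limit P x)" "u \<noteq> Map.empty" "\<nexists>\<beta>. dom u = {..\<beta>}"
      "disjoint P" "{} \<notin> P" "\<And>V. V \<in> P \<Longrightarrow> openin X V" "core X u = \<Union>P \<union> {x}" "x \<notin> \<Union>P"
      "limit_pair X u P x"
proof -
  obtain m where m: "\<sigma> u = Some m" "legal_move X u m" using move[OF assms] by blast
  consider "u = Map.empty" | \<beta> where "u \<noteq> Map.empty" "dom u = {..\<beta>}"
    | "u \<noteq> Map.empty" "\<nexists>\<beta>. dom u = {..\<beta>}" by blast
  then show thesis
  proof cases
    case 1
    then have "core X u = topspace X" by (simp add: core_def)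
    with 1 m show ?thesis
      by (intro succ[of "offer m"]) (auto simp: legal_move_def open_partition_def partition_on_def)
  next
    case 2
    then obtain P \<gamma> where P: "m = Partition P" "dom u = {..\<gamma>}" "open_partition X (the (u \<gamma>)) P"
      using m unfolding legal_move_def by (auto split: if_splits)
    then obtain U where "u \<gamma> = Some U" by (metis atMost_iff domD order_refl)
    then have "core X u = the (u \<gamma>)" using core_last[OF assms P(2)] by simp
    with 2 m P show ?thesis
      by (intro succ[of P]) (auto simp: open_partition_def partition_on_def)
  next
    case 3
    then obtain P x where P: "m = Limit P x" "limit_pair X u P x"
      using m unfolding legal_move_def by (auto split: if_splits)
    obtain W where "W \<in> ran u" using 3(1) unfolding fun_eq_iff by (metis not_None_eq ranI)
    moreover have "W \<subseteq> topspace X" if "W \<in> ran u" for W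
      using that played_open(3)[OF assms] by (auto simp: ran_def)
    ultimately have "core X u = \<Inter>(ran u)" unfolding core_def by blast
    with 3 m P show ?thesis
      by (intro limit[of P x]) (auto simp: limit_pair_def)
  qed
qed

lemma offer_disjoint:
  assumes "played \<sigma> u" "\<sigma> u = Some m" "U \<in> offer m" "V \<in> offer m" "x \<in> U" "x \<in> V"
  shows "U = V"
  using move_cases[OF assms(1)] assms(2-) by cases (auto dest: disjointD)

lemma core_antimono: "u \<subseteq>\<^sub>m v \<Longrightarrow> core X v \<subseteq> core X u"
  unfolding core_def map_le_def ran_def by (auto simp: dom_def) metis

lemma extend:
  assumes "played \<sigma> u" "dom u = {..<\<alpha>}" "\<sigma> u = Some m" "V \<in> offer m"
  shows "u(\<alpha> \<mapsto> V) \<in> S" "core X (u(\<alpha> \<mapsto> V)) = V" "u \<subseteq>\<^sub>m u(\<alpha> \<mapsto> V)" "u \<noteq> u(\<alpha> \<mapsto> V)"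
proof -
  have p: "played \<sigma> (u(\<alpha> \<mapsto> V))" using played_fun_upd[OF assms] .
  have d: "dom (u(\<alpha> \<mapsto> V)) = {..\<alpha>}" using assms(2) by auto
  show "u(\<alpha> \<mapsto> V) \<in> S" using p d S_iff by blast
  show "core X (u(\<alpha> \<mapsto> V)) = V" using core_last[OF p d] by simp
  show "u \<subseteq>\<^sub>m u(\<alpha> \<mapsto> V)" using assms(2) by (auto simp: map_le_def)
  have "\<alpha> \<notin> dom u" using assms(2) by simp
  then have "u \<alpha> \<noteq> (u(\<alpha> \<mapsto> V)) \<alpha>" by (simp add: domIff)
  then show "u \<noteq> u(\<alpha> \<mapsto> V)" by metis
qed

text \<open>For continuity of \<open>point_ray\<close>, avoiding a node must be an open condition.
  The complement of \<open>U\<close> consists of what earlier moves have lost, the other offered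
  sets and, at a limit, Alice's point, which needs an open set around it that misses
  \<open>U\<close>.\<close>

lemma clopen_complement:
  assumes "played \<sigma> u" "u \<beta> = Some U"
  shows "openin X (topspace X - U)"
  using assms(2)
proof (induction \<beta> arbitrary: U rule: less_induct)
  case (less \<beta>)
  let ?v = "u |` {..<\<beta>}"
  have pv: "played \<sigma> ?v" using played_restrict(1)[OF assms(1)] .
  obtain m where m: "\<sigma> ?v = Some m" "U \<in> offer m" using last_move[OF assms(1) less.prems] by metis
  have "openin X (topspace X - W)" if "W \<in> ran ?v" for W
    using that less.IH by (auto simp: ran_def restrict_map_def split: if_splits)
  then have "openin X (\<Union>W\<in>ran ?v. topspace X - W)" by blast
  moreover have "(\<Union>W\<in>ran ?v. topspace X - W) = topspace X - core X ?v" by (auto simp: core_def)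
  ultimately have o1: "openin X (topspace X - core X ?v)" by simp
  from pv show ?case
  proof (cases rule: move_cases)
    case (succ P)
    then have "topspace X - U = (topspace X - core X ?v) \<union> \<Union>(P - {U})"
      using m by (auto simp: core_def dest: disjointD)
    moreover have "openin X (\<Union>(P - {U}))" using succ by blast
    ultimately show ?thesis using o1 by (metis openin_Un)
  next
    case (limit P x)
    obtain W where W: "W \<in> ran ?v" using limit(2) unfolding fun_eq_iff by (metis not_None_eq ranI)
    have U: "U \<in> P" using m limit(1) by (metis offer.simps(2) option.inject)
    \<comment> \<open>The member of the local basis with \<open>F = {U}\<close> is such a
      neighbourhood of Alice's point.\<close>
    have "openin X (W - \<Union>{U}) \<and> x \<in> W - \<Union>{U}"
      using limit(9) W U unfolding limit_pair_def local_basis_at_def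
      by (metis (mono_tags, lifting) CollectI empty_subsetI finite.emptyI finite.insertI insert_subset)
    then have o2: "openin X (W - U)" "x \<in> W - U" by auto
    have "topspace X - U = (topspace X - core X ?v) \<union> \<Union>(P - {U}) \<union> (W - U)"
    proof -
      have "W \<subseteq> topspace X" using o2 W played_open(3)[OF pv] by (auto simp: ran_def)
      moreover have "core X ?v - U = \<Union>(P - {U}) \<union> {x}"
        using limit U by (auto dest: disjointD)
      moreover have "core X ?v \<subseteq> topspace X" by (auto simp: core_def)
      moreover have "U \<subseteq> core X ?v" using limit(7) U by blast
      moreover have "U \<inter> \<Union>(P - {U}) = {}" using limit(4) U by (auto dest: disjointD)
      ultimately show ?thesis using o2(2) by blast
    qed
    moreover have "openin X (\<Union>(P - {U}))" using limit by blast
    ultimately show ?thesis using o1 o2(1) by (metis openin_Un)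
  qed
qed

lemma core_clopen:
  assumes "u \<in> S"
  shows "openin X (core X u)" "openin X (topspace X - core X u)"
proof -
  have "openin X (core X u) \<and> openin X (topspace X - core X u)"
  proof (cases "u = Map.empty")
    case True then show ?thesis by (simp add: core_def)
  next
    case False
    then obtain \<beta> where b: "played \<sigma> u" "dom u = {..\<beta>}" using assms S_iff by blast
    then obtain U where U: "u \<beta> = Some U" by (metis atMost_iff domD order_refl)
    then show ?thesis
      using core_last[OF b U] clopen_complement[OF b(1) U] played_open(1)[OF b(1) U] by simp
  qed
  then show "openin X (core X u)" "openin X (topspace X - core X u)" by auto
qed

lemma core_nonempty:
  assumes "u \<in> S" shows "core X u \<noteq> {}"
proof (cases "u = Map.empty")
  case True then show ?thesis using nonempty by (simp add: core_def)
next
  case False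
  then obtain \<beta> where b: "played \<sigma> u" "dom u = {..\<beta>}" using assms S_iff by blast
  then obtain U where U: "u \<beta> = Some U" by (metis atMost_iff domD order_refl)
  then show ?thesis using core_last[OF b U] played_open(2)[OF b(1) U] by simp
qed

text \<open>A member of \<open>S\<close> never has limit length, so Alice answers it with a
  partition of its core, and some part catches \<open>x\<close>.\<close>

lemma S_successor:
  assumes "u \<in> S" "x \<in> core X u"
  obtains v where "v \<in> S" "x \<in> core X v" "u \<subseteq>\<^sub>m v" "u \<noteq> v"
proof -
  have pu: "played \<sigma> u" using assms S_iff by blast
  obtain \<alpha> where a: "dom u = {..<\<alpha>}" using played_initial[OF pu] .
  from pu show thesis
  proof (cases rule: move_cases)
    case (succ P)
    then obtain V where "V \<in> P" "x \<in> V" using assms by blast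
    then show thesis using that[of "u(\<alpha> \<mapsto> V)"] extend[OF pu a succ(1), of V] by simp
  next
    case limit
    then show thesis using assms S_iff by blast
  qed
qed

text \<open>By induction the histories before \<beta> coincide, hence so does Alice's offer, and
  disjointness leaves one offered set containing \<open>x\<close>. This makes the positions that
  keep \<open>x\<close> a chain.\<close>

lemma played_agree:
  assumes "played \<sigma> u" "played \<sigma> v" "x \<in> core X u" "x \<in> core X v" "\<beta> \<in> dom u" "\<beta> \<in> dom v"
  shows "u \<beta> = v \<beta>"
  using assms(5,6)
proof (induction \<beta> rule: less_induct)
  case (less \<beta>)
  obtain U V where UV: "u \<beta> = Some U" "v \<beta> = Some V" using less.prems by blast
  have "u |` {..<\<beta>} = v |` {..<\<beta>}"
  proof
    fix \<gamma>
    show "(u |` {..<\<beta>}) \<gamma> = (v |` {..<\<beta>}) \<gamma>"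
      using less assms(1,2)[THEN played_is_seq] unfolding is_seq_def restrict_map_def by auto
  qed
  moreover obtain m where "\<sigma> (u |` {..<\<beta>}) = Some m" "U \<in> offer m"
    using last_move[OF assms(1) UV(1)] by metis
  moreover obtain m' where "\<sigma> (v |` {..<\<beta>}) = Some m'" "V \<in> offer m'"
    using last_move[OF assms(2) UV(2)] by metis
  moreover have "x \<in> U" "x \<in> V" using assms(3,4) ranI[of u, OF UV(1)] ranI[of v, OF UV(2)] by (auto simp: core_def)
  ultimately have "U = V"
    using offer_disjoint[OF played_restrict(1)[OF assms(1)], of \<beta> m U V x] by simp
  then show ?case using UV by simp
qed

lemma comparable:
  assumes "played \<sigma> u" "played \<sigma> v" "x \<in> core X u" "x \<in> core X v"
  shows "u \<subseteq>\<^sub>m v \<or> v \<subseteq>\<^sub>m u"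
  using is_seq_comparable[OF assms(1,2)[THEN played_is_seq]] played_agree[OF assms] by blast

section \<open>The correspondence between points and rays\<close>

definition point_ray :: "'a \<Rightarrow> ('a inning, 'a) bob_seq set" where
  "point_ray x = {u \<in> S. x \<in> core X u}"

lemma empty_in_S: "Map.empty \<in> S"
  unfolding succ_seqs_def by blast

lemma point_ray_in_rays:
  assumes "x \<in> topspace X" shows "point_ray x \<in> rays S r"
  unfolding rays_def
proof (intro CollectI conjI)
  show "point_ray x \<subseteq> S" by (auto simp: point_ray_def)
  show "point_ray x \<noteq> {}" using empty_in_S assms by (auto simp: point_ray_def core_def)
  show "\<forall>t\<in>point_ray x. \<forall>s\<in>S. (s, t) \<in> r \<longrightarrow> s \<in> point_ray x"
    using core_antimono by (auto simp: point_ray_def ext_order_def)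
  show "point_ray x \<in> Chains r"
    unfolding Chains_def ext_order_def point_ray_def using comparable S_iff by blast
  show "no_maximal r (point_ray x)"
    unfolding no_maximal_def
  proof
    assume "\<exists>m\<in>point_ray x. \<forall>y\<in>point_ray x. (m, y) \<in> r \<longrightarrow> y = m"
    then obtain u where u: "u \<in> S" "x \<in> core X u" "\<forall>y\<in>point_ray x. (u, y) \<in> r \<longrightarrow> y = u"
      by (auto simp: point_ray_def)
    then show False using S_successor[OF u(1,2)] by (auto simp: point_ray_def ext_order_def)
  qed
qed

text \<open>The sequences of a ray glue to one position \<open>u\<close>. It is outside the ray,
  where nothing is maximal, so its length is a limit and Alice must name a point. The position and
  its limit pair are returned as well, because openness of \<open>point_ray\<close> needs the local
  basis found there.\<close>

lemma ray_limit:
  assumes R: "R \<in> rays S r"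
  obtains u P x where "played \<sigma> u" "\<sigma> u = Some (Limit P x)" "limit_pair X u P x"
    "\<And>w. w \<in> R \<Longrightarrow> w \<subseteq>\<^sub>m u" "\<And>\<beta>. \<beta> \<in> dom u \<Longrightarrow> u |` {..\<beta>} \<in> R"
    "x \<in> topspace X" "point_ray x = R" "\<And>y. y \<in> topspace X \<Longrightarrow> point_ray y = R \<Longrightarrow> y = x"
proof -
  have RS: "R \<subseteq> S" and Rne: "R \<noteq> {}" and Rdown: "\<And>t s. t \<in> R \<Longrightarrow> s \<in> S \<Longrightarrow> s \<subseteq>\<^sub>m t \<Longrightarrow> s \<in> R"
    and Rchain: "\<And>s t. s \<in> R \<Longrightarrow> t \<in> R \<Longrightarrow> s \<subseteq>\<^sub>m t \<or> t \<subseteq>\<^sub>m s"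
    and Rmax: "\<And>m. m \<in> R \<Longrightarrow> \<exists>y\<in>R. m \<subseteq>\<^sub>m y \<and> y \<noteq> m"
    using R unfolding rays_def no_maximal_def Chains_def ext_order_def by blast+
  have RP: "played \<sigma> w" if "w \<in> R" for w using that RS S_iff by blast
  \<comment> \<open>Any member of \<open>R\<close> defined at \<beta> would do: members are pairwise
    comparable, and \<open>wu\<close> records that the choice is immaterial.\<close>
  define u where "u = (\<lambda>\<beta>. if \<exists>w\<in>R. \<beta> \<in> dom w then (SOME w. w \<in> R \<and> \<beta> \<in> dom w) \<beta> else None)"
  have wu: "u \<beta> = w \<beta>" if "w \<in> R" "\<beta> \<in> dom w" for w \<beta>
  proof -
    let ?w = "SOME w. w \<in> R \<and> \<beta> \<in> dom w"
    have "w \<in> R \<and> \<beta> \<in> dom w" using that by blast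
    then have "?w \<in> R \<and> \<beta> \<in> dom ?w" 
      by (rule someI[of "\<lambda>w. w \<in> R \<and> \<beta> \<in> dom w"])
    then have "?w \<beta> = w \<beta>" using Rchain that unfolding map_le_def by metis
    then show ?thesis using that unfolding u_def by auto
  qed
  have wle: "w \<subseteq>\<^sub>m u" if "w \<in> R" for w using wu that unfolding map_le_def by metis
  have domu: "dom u = (\<Union>w\<in>R. dom w)"
  proof
    show "dom u \<subseteq> (\<Union>w\<in>R. dom w)" unfolding u_def by (auto split: if_splits)
    show "(\<Union>w\<in>R. dom w) \<subseteq> dom u" using wle map_le_implies_dom_le by blast
  qed
  have res: "u |` {..<\<beta>} = w |` {..<\<beta>}" "u |` {..\<beta>} = w |` {..\<beta>}" if "w \<in> R" "\<beta> \<in> dom w" for w \<beta>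
  proof -
    have "{..\<beta>} \<subseteq> dom w" "{..<\<beta>} \<subseteq> dom w"
      using initial_subset[OF played_is_seq[OF RP[OF that(1)]] that(2)] by simp_all
    then show "u |` {..<\<beta>} = w |` {..<\<beta>}" "u |` {..\<beta>} = w |` {..\<beta>}"
      using restrict_restrict_map_le[OF wle[OF that(1)]] by metis+
  qed
  have pu: "played \<sigma> u"
    unfolding played_def
  proof (intro conjI ballI)
    show "is_seq u"
      unfolding is_seq_def
    proof (intro ballI allI impI)
      fix \<beta> \<gamma> assume "\<beta> \<in> dom u" "\<gamma> < \<beta>"
      then obtain w where w: "w \<in> R" "\<beta> \<in> dom w" using domu by blast
      have "\<gamma> \<in> dom w" using played_is_seq[OF RP[OF w(1)]] w(2) \<open>\<gamma> < \<beta>\<close>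
        unfolding is_seq_def by blast
      then show "\<gamma> \<in> dom u" using domu w(1) by blast
    qed
    fix \<beta> assume "\<beta> \<in> dom u"
    then obtain w where w: "w \<in> R" "\<beta> \<in> dom w" using domu by blast
    then show "\<exists>m. \<sigma> (u |` {..<\<beta>}) = Some m \<and> the (u \<beta>) \<in> offer m"
      using RP[OF w(1)] res(1)[OF w] wu[OF w] unfolding played_def by simp
  qed
  have inR: "u |` {..\<beta>} \<in> R" if "\<beta> \<in> dom u" for \<beta>
  proof -
    obtain w where w: "w \<in> R" "\<beta> \<in> dom w" using \<open>\<beta> \<in> dom u\<close> domu by blast
    have "w |` {..\<beta>} \<in> S"
      unfolding S_iff using played_restrict(2)[OF RP[OF w(1)], of \<beta>]
        dom_restrict_initial(2)[OF played_is_seq[OF RP[OF w(1)]] w(2)] by blast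
    then show ?thesis using Rdown[OF w(1)] map_le_restrict[of w] res(2)[OF w] by simp
  qed
  have notR: "u \<notin> R"
    using Rmax wle map_le_antisym by metis
  obtain w where w: "w \<in> R" using Rne by blast
  then obtain w' where "w' \<in> R" "w \<subseteq>\<^sub>m w'" "w' \<noteq> w" using Rmax by blast
  then have ue: "u \<noteq> Map.empty" using wle w by (metis map_le_antisym map_le_empty)
  have us: "\<nexists>\<beta>. dom u = {..\<beta>}"
  proof
    assume "\<exists>\<beta>. dom u = {..\<beta>}"
    then obtain \<beta> where b: "dom u = {..\<beta>}" by blast
    then have "u |` {..\<beta>} = u" using map_le_eq_restrict[of u u] by simp
    then show False using inR[of \<beta>] b notR by simp
  qed
  obtain \<alpha> where a: "dom u = {..<\<alpha>}" using played_initial[OF pu] .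
  from pu obtain P x where P: "\<sigma> u = Some (Limit P x)" "core X u = \<Union>P \<union> {x}" "x \<notin> \<Union>P"
    "limit_pair X u P x"
    using ue us by (cases rule: move_cases) blast+
  have "x \<in> core X u" using P by blast
  then have xw: "x \<in> core X w" if "w \<in> R" for w using core_antimono[OF wle[OF that]] by blast
  \<comment> \<open>A sequence \<open>v\<close> that keeps \<open>x\<close> but is outside
    \<open>R\<close> would extend all of \<open>R\<close>, hence properly extend \<open>u\<close>;
    its move in inning \<alpha> would be an offered set containing \<open>x\<close>, which the limit
    pair excludes.\<close>
  have "v \<in> R" if v: "v \<in> S" "x \<in> core X v" for v
  proof (rule ccontr)
    assume vR: "v \<notin> R"
    have pv: "played \<sigma> v" using v S_iff by blast
    have "w \<subseteq>\<^sub>m v" if "w \<in> R" for w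
      using comparable[OF RP[OF that] pv xw[OF that] v(2)] Rdown[OF that v(1)] vR by blast
    then have uv: "u \<subseteq>\<^sub>m v" using wu domu unfolding map_le_def by (metis UN_E)
    have "u \<noteq> v" using us ue v(1) S_iff by blast
    then have "\<not> dom v \<subseteq> dom u" using uv by (metis map_le_antisym map_le_def subsetD)
    then obtain \<beta> where "\<beta> \<in> dom v" "\<alpha> \<le> \<beta>" using a by (metis lessThan_iff not_less subsetI)
    then have "\<alpha> \<in> dom v" using played_is_seq[OF pv] unfolding is_seq_def by (metis le_less)
    then obtain V where V: "v \<alpha> = Some V" by blast
    have "v |` {..<\<alpha>} = u" using map_le_eq_restrict[OF uv] a by simp
    then have "V \<in> P" using last_move[OF pv V] P(1) by fastforce
    moreover have "x \<in> V" using v(2) ranI[of v, OF V] by (auto simp: core_def)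
    ultimately show False using P(3) by blast
  qed
  then have eq: "point_ray x = R" using RS xw by (auto simp: point_ray_def)
  \<comment> \<open>Another point \<open>y\<close> with this ray survives all of \<open>u\<close>
    and so lies in an offered set \<open>V\<close>; then \<open>u(\<alpha> \<mapsto> V)\<close> is
    in the ray of \<open>y\<close>, that is in \<open>R\<close>, although no member of
    \<open>R\<close> reaches inning \<alpha>.\<close>
  have uni: "y = x" if y: "y \<in> topspace X" "point_ray y = R" for y
  proof (rule ccontr)
    assume "y \<noteq> x"
    have "y \<in> W" if "W \<in> ran u" for W
    proof -
      obtain \<beta> where b: "u \<beta> = Some W" using \<open>W \<in> ran u\<close> by (auto simp: ran_def)
      then have "u |` {..\<beta>} \<in> point_ray y" using inR y by blast
      moreover have "W \<in> ran (u |` {..\<beta>})" using b by (intro ranI[of _ \<beta>]) simp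
      ultimately show ?thesis by (auto simp: point_ray_def core_def)
    qed
    then have "y \<in> core X u" using y by (auto simp: core_def)
    then obtain V where V: "V \<in> P" "y \<in> V" using P \<open>y \<noteq> x\<close> by blast
    then have "u(\<alpha> \<mapsto> V) \<in> R"
      using extend[OF pu a P(1), of V] y by (auto simp: point_ray_def)
    moreover have "\<alpha> \<in> dom (u(\<alpha> \<mapsto> V))" by simp
    ultimately have "\<alpha> \<in> dom u" using domu by blast
    then show False using a by simp
  qed
  have xX: "x \<in> topspace X" using P(2) by (auto simp: core_def)
  show thesis by (rule that[OF pu P(1,4) wle inR xX eq uni])
qed

text \<open>Sequences below \<open>t\<close> are ordered like their lengths: the first unplayed
  inning \<open>h\<close> strictly grows under proper extension, and innings are
  well-ordered.\<close>

lemma map_le_S_wellorder: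
  assumes t: "t \<in> S"
  shows "well_order_on {s \<in> S. (s, t) \<in> r} (Restr r {s \<in> S. (s, t) \<in> r})"
proof -
  let ?D = "{s \<in> S. (s, t) \<in> r}"
  have le: "s \<subseteq>\<^sub>m t" "s \<in> S" if "s \<in> ?D" for s using that by (auto simp: ext_order_def)
  have tot: "s \<subseteq>\<^sub>m s' \<or> s' \<subseteq>\<^sub>m s" if "s \<in> ?D" "s' \<in> ?D" for s s'
  proof (rule is_seq_comparable)
    show "is_seq s" "is_seq s'" using that le(2) S_iff played_is_seq by blast+
    show "s \<beta> = s' \<beta>" if "\<beta> \<in> dom s" "\<beta> \<in> dom s'" for \<beta>
      using that le(1)[OF \<open>s \<in> ?D\<close>] le(1)[OF \<open>s' \<in> ?D\<close>] unfolding map_le_def by metis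
  qed
  define h where "h = (\<lambda>s :: ('a inning, 'a) bob_seq. LEAST \<alpha>. \<alpha> \<notin> dom s)"
  have "h s < h s'" if s: "s \<in> S" "s' \<in> S" "s \<subseteq>\<^sub>m s'" "s \<noteq> s'" for s s'
  proof -
    have hd: "dom w = {..<h w}" if w: "w \<in> S" for w
    proof -
      obtain \<alpha> where a: "dom w = {..<\<alpha>}" using played_initial w S_iff by metis
      have "h w = \<alpha>" unfolding h_def a by (rule Least_equality) auto
      then show ?thesis using a by simp
    qed
    have "dom s \<noteq> dom s'"
      using s(3,4) map_le_eq_restrict[of s s'] map_le_eq_restrict[of s' s'] by auto
    moreover have "dom s \<subseteq> dom s'" using s(3) by (rule map_le_implies_dom_le)
    ultimately show ?thesis using s hd by auto
  qed
  then have h_mono: "h s < h s'" if "(s, s') \<in> Restr r ?D - Id" for s s'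
    using that unfolding ext_order_def by blast
  have "Restr r ?D - Id \<subseteq> inv_image {(x, y). x < y} h"
  proof (rule subrelI)
    fix s s' assume "(s, s') \<in> Restr r ?D - Id"
    then have "h s < h s'" by (rule h_mono)
    then show "(s, s') \<in> inv_image {(x, y). x < y} h" by simp
  qed
  then have "wf (Restr r ?D - Id)" by (rule wf_subset[OF wf_inv_image[OF wf]])
  then show ?thesis
    using tot unfolding order_on_defs
    by (auto simp: refl_on_def trans_def antisym_def total_on_def ext_order_def
        intro: map_le_trans map_le_antisym)
qed

lemma pruned_tree_S: "pruned_tree S r"
  unfolding pruned_tree_def set_tree_def
proof (intro conjI ballI)
  show "partial_order_on S r"
    unfolding order_on_defs
    by (auto simp: refl_on_def trans_def antisym_def ext_order_def intro: map_le_trans map_le_antisym)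
  show "\<exists>m\<in>S. \<forall>t\<in>S. (m, t) \<in> r"
    using empty_in_S by (intro bexI[of _ Map.empty]) (auto simp: ext_order_def)
  show "no_maximal r S"
    unfolding no_maximal_def
  proof
    assume "\<exists>m\<in>S. \<forall>y\<in>S. (m, y) \<in> r \<longrightarrow> y = m"
    then obtain u where u: "u \<in> S" "\<forall>y\<in>S. (u, y) \<in> r \<longrightarrow> y = u" by blast
    obtain x where "x \<in> core X u" using core_nonempty[OF u(1)] by blast
    then show False using S_successor[OF u(1)] u by (auto simp: ext_order_def)
  qed
qed (rule map_le_S_wellorder)

text \<open>Continuity holds because cores of nodes are clopen, so a finite condition on rays is an
  open condition on points. Bijectivity is existence and uniqueness in \<open>ray_limit\<close>;
  openness is the local basis at the limit position of the ray.\<close>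

lemma homeomorphic_point_ray: "homeomorphic_map X (ray_space S r) point_ray"
proof (rule bijective_open_imp_homeomorphic_map)
  show "continuous_map X (ray_space S r) point_ray"
    unfolding continuous_map_def topspace_ray_space
  proof (intro conjI allI impI)
    show "point_ray \<in> topspace X \<rightarrow> rays S r" using point_ray_in_rays by blast
    fix W assume W: "openin (ray_space S r) W"
    show "openin X {x \<in> topspace X. point_ray x \<in> W}"
    proof (subst openin_subopen, intro ballI)
      fix x assume "x \<in> {x \<in> topspace X. point_ray x \<in> W}"
      then have x: "x \<in> topspace X" "point_ray x \<in> W" by auto
      obtain E F where EF: "finite E" "finite F" "E \<subseteq> point_ray x" "F \<subseteq> S - point_ray x"
        "\<forall>R'\<in>rays S r. E \<subseteq> R' \<and> F \<inter> R' = {} \<longrightarrow> R' \<in> W"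
        using W x(2) unfolding openin_ray_space by meson
      \<comment> \<open>Containing a node of \<open>E\<close> means lying in its core, avoiding a
        node of \<open>F\<close> means lying outside it. The factor \<open>topspace X\<close> below
        takes care of an empty list of conditions.\<close>
      let ?C = "core X ` E \<union> (\<lambda>t. topspace X - core X t) ` F"
      have "openin X (topspace X \<inter> \<Inter>?C)"
      proof (cases "?C = {}")
        case False
        have "openin X V" if "V \<in> ?C" for V
          using that EF(3,4) core_clopen by (auto simp: point_ray_def)
        then have "openin X (\<Inter>?C)" using False EF(1,2) by (intro openin_Inter) auto
        then show ?thesis by blast
      qed simp
      moreover have "x \<in> topspace X \<inter> \<Inter>?C"
        using x EF(3,4) by (auto simp: point_ray_def)
      moreover have "topspace X \<inter> \<Inter>?C \<subseteq> {x \<in> topspace X. point_ray x \<in> W}"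
      proof
        fix y assume y: "y \<in> topspace X \<inter> \<Inter>?C"
        have "E \<subseteq> point_ray y" "F \<inter> point_ray y = {}" using y EF(3,4) by (auto simp: point_ray_def)
        moreover have "y \<in> topspace X" using y by blast
        ultimately show "y \<in> {x \<in> topspace X. point_ray x \<in> W}"
          using EF(5) point_ray_in_rays[of y] by simp
      qed
      ultimately show "\<exists>V. openin X V \<and> x \<in> V \<and> V \<subseteq> {x \<in> topspace X. point_ray x \<in> W}" by blast
    qed
  qed
  show im: "point_ray ` topspace X = topspace (ray_space S r)"
    unfolding topspace_ray_space
  proof
    show "rays S r \<subseteq> point_ray ` topspace X"
    proof
      fix R assume "R \<in> rays S r"
      then show "R \<in> point_ray ` topspace X" by (rule ray_limit) blast
    qed
  qed (use point_ray_in_rays in blast)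
  show inj: "inj_on point_ray (topspace X)"
  proof (rule inj_onI)
    fix x y assume "x \<in> topspace X" "y \<in> topspace X" "point_ray x = point_ray y"
    then show "x = y" using ray_limit[OF point_ray_in_rays[of x]] by metis
  qed
  show "open_map X (ray_space S r) point_ray"
    unfolding open_map_def openin_ray_space
  proof (intro allI impI conjI ballI)
    fix W assume W: "openin X W"
    then have WX: "W \<subseteq> topspace X" by (rule openin_subset)
    then show "point_ray ` W \<subseteq> rays S r" using point_ray_in_rays by blast
    fix R assume "R \<in> point_ray ` W"
    then obtain x where x: "x \<in> W" "R = point_ray x" by blast
    have "R \<in> rays S r" using x point_ray_in_rays WX by blast
    \<comment> \<open>Uniqueness in \<open>ray_limit\<close> identifies the point that Alice names
      with the given \<open>x\<close>.\<close>
    then obtain u P where u: "played \<sigma> u" "\<sigma> u = Some (Limit P x)" "limit_pair X u P x"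
      "\<And>\<beta>. \<beta> \<in> dom u \<Longrightarrow> u |` {..\<beta>} \<in> R"
    proof (rule ray_limit)
      fix u P z
      assume z: "played \<sigma> u" "\<sigma> u = Some (Limit P z)" "limit_pair X u P z"
        "\<And>\<beta>. \<beta> \<in> dom u \<Longrightarrow> u |` {..\<beta>} \<in> R"
        and "\<And>y. y \<in> topspace X \<Longrightarrow> point_ray y = R \<Longrightarrow> y = z"
      then have "x = z" using x WX by blast
      with z show thesis using that by blast
    qed
    have "local_basis_at X x {U - \<Union>F | U F. U \<in> ran u \<and> finite F \<and> F \<subseteq> P}"
      using u(3) unfolding limit_pair_def by blast
    then have "\<exists>V\<in>{U - \<Union>F | U F. U \<in> ran u \<and> finite F \<and> F \<subseteq> P}. V \<subseteq> W"
      using W x(1) unfolding local_basis_at_def by simp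
    then obtain U F where F: "U \<in> ran u" "finite F" "F \<subseteq> P" "U - \<Union>F \<subseteq> W" by blast
    obtain \<beta> where b: "u \<beta> = Some U" using F(1) by (auto simp: ran_def)
    obtain \<alpha> where a: "dom u = {..<\<alpha>}" using played_initial[OF u(1)] .
    have ext: "u(\<alpha> \<mapsto> V) \<in> S" "core X (u(\<alpha> \<mapsto> V)) = V" if "V \<in> P" for V
      using extend[OF u(1) a u(2), of V] that by auto
    have "\<beta> \<in> dom u" using b by blast
    then have core_b: "core X (u |` {..\<beta>}) = U"
      using b by (intro core_last[OF played_restrict(2)[OF u(1)]
            dom_restrict_initial(2)[OF played_is_seq[OF u(1)]]]) simp_all
    \<comment> \<open>\<open>U\<close> is the core of the prefix ending in inning \<beta>, and each
      removed \<open>V\<close> is the core of \<open>u\<close> extended by \<open>V\<close>; so this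
      condition on the ray of a point says that the point lies in
      \<open>U - \<Union>F\<close>.\<close>
    let ?E = "{u |` {..\<beta>}}" and ?F = "(\<lambda>V. u(\<alpha> \<mapsto> V)) ` F"
    have xP: "x \<notin> \<Union>P" using u(3) unfolding limit_pair_def by blast
    have "R' \<in> point_ray ` W" if R': "R' \<in> rays S r" "?E \<subseteq> R'" "?F \<inter> R' = {}" for R'
    proof -
      have "R' \<in> point_ray ` topspace X" using R'(1) im by (simp add: topspace_ray_space)
      then obtain y where y: "y \<in> topspace X" "R' = point_ray y" by blast
      have "y \<in> U" using R'(2) y core_b by (auto simp: point_ray_def)
      moreover have "y \<notin> V" if "V \<in> F" for V
        using R'(3) y ext[of V] that F(3) by (auto simp: point_ray_def)
      ultimately show ?thesis using F(4) y by blast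
    qed
    moreover have "?E \<subseteq> R" using u(4) b by blast
    moreover have "?F \<subseteq> S - R" using ext F(3) xP x(2) by (auto simp: point_ray_def)
    ultimately show "\<exists>E F. finite E \<and> finite F \<and> E \<subseteq> R \<and> F \<subseteq> S - R \<and>
        (\<forall>R'\<in>rays S r. E \<subseteq> R' \<and> F \<inter> R' = {} \<longrightarrow> R' \<in> point_ray ` W)"
      using F(2) by (rule_tac x = ?E in exI, rule_tac x = ?F in exI) auto
  qed
qed

end

section \<open>The strategy given by a tree\<close>

definition below :: "'t set \<Rightarrow> 't rel \<Rightarrow> 't \<Rightarrow> 't set" where
  "below T r t = {s \<in> T. (s, t) \<in> r \<and> s \<noteq> t}"

text \<open>If \<open>C\<close> consists of all nodes up to some \<open>t\<close>, these are the
  children of \<open>t\<close>; if \<open>C\<close> is a branch without last node, they are the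
  nodes of limit height directly over it, possibly none.\<close>

definition tops :: "'t set \<Rightarrow> 't rel \<Rightarrow> 't set \<Rightarrow> 't set" where
  "tops T r C = {s \<in> T. below T r s = C}"

definition down_closed :: "'t set \<Rightarrow> 't rel \<Rightarrow> 't set \<Rightarrow> bool" where
  "down_closed T r C \<longleftrightarrow> C \<subseteq> T \<and> (\<forall>c\<in>C. \<forall>s\<in>T. (s, c) \<in> r \<longrightarrow> s \<in> C)"

locale tree_of_space =
  fixes T :: "'t set" and r :: "'t rel" and X :: "'a topology" and h :: "'t set \<Rightarrow> 'a"
  assumes pruned: "pruned_tree T r"
    and homeo: "homeomorphic_map (ray_space T r) X h"
begin

section \<open>Order facts and rays of a pruned tree\<close>

lemma order:
  shows r_in_T: "(s, t) \<in> r \<Longrightarrow> s \<in> T \<and> t \<in> T"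
    and r_refl: "t \<in> T \<Longrightarrow> (t, t) \<in> r"
    and r_trans: "(s, t) \<in> r \<Longrightarrow> (t, t') \<in> r \<Longrightarrow> (s, t') \<in> r"
    and r_antisym: "(s, t) \<in> r \<Longrightarrow> (t, s) \<in> r \<Longrightarrow> s = t"
proof -
  have "partial_order_on T r" using pruned unfolding pruned_tree_def set_tree_def by blast
  then have p: "r \<subseteq> T \<times> T" "refl_on T r" "trans r" "antisym r" unfolding order_on_defs by auto
  show "(s, t) \<in> r \<Longrightarrow> s \<in> T \<and> t \<in> T" using p(1) by blast
  show "t \<in> T \<Longrightarrow> (t, t) \<in> r" using p(2) by (simp add: refl_on_def)
  show "(s, t) \<in> r \<Longrightarrow> (t, t') \<in> r \<Longrightarrow> (s, t') \<in> r" using p(3) by (rule transD)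
  show "(s, t) \<in> r \<Longrightarrow> (t, s) \<in> r \<Longrightarrow> s = t" using p(4) by (rule antisymD)
qed

definition root :: 't where "root = (SOME m. m \<in> T \<and> (\<forall>t\<in>T. (m, t) \<in> r))"

lemma root: "root \<in> T" "t \<in> T \<Longrightarrow> (root, t) \<in> r"
proof -
  have "\<exists>m. m \<in> T \<and> (\<forall>t\<in>T. (m, t) \<in> r)"
    using pruned unfolding pruned_tree_def set_tree_def by blast
  then have "root \<in> T \<and> (\<forall>t\<in>T. (root, t) \<in> r)" unfolding root_def by (rule someI_ex)
  then show "root \<in> T" "t \<in> T \<Longrightarrow> (root, t) \<in> r" by blast+
qed

lemma no_max: "t \<in> T \<Longrightarrow> \<exists>s\<in>T. (t, s) \<in> r \<and> s \<noteq> t"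
  using pruned unfolding pruned_tree_def no_maximal_def by blast

lemma initial_wellorder:
  assumes "t \<in> T"
  shows "well_order_on {s \<in> T. (s, t) \<in> r} (Restr r {s \<in> T. (s, t) \<in> r})"
proof -
  have "\<forall>t\<in>T. well_order_on {s \<in> T. (s, t) \<in> r} (Restr r {s \<in> T. (s, t) \<in> r})"
    using pruned unfolding pruned_tree_def set_tree_def by (elim conjE)
  then show ?thesis using assms by (rule bspec)
qed

lemma r_total_below:
  assumes "(s, t) \<in> r" "(s', t) \<in> r"
  shows "(s, s') \<in> r \<or> (s', s) \<in> r"
proof -
  have T: "s \<in> T" "s' \<in> T" "t \<in> T" using assms r_in_T by blast+
  have "total_on {s \<in> T. (s, t) \<in> r} (Restr r {s \<in> T. (s, t) \<in> r})"
    using initial_wellorder[OF T(3)] unfolding order_on_defs by blast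
  then show ?thesis
    using assms T r_refl[OF T(1)] by (cases "s = s'") (simp_all add: total_on_def)
qed

lemma least_element:
  assumes "t \<in> B" "B \<subseteq> {s \<in> T. (s, t') \<in> r}"
  obtains m where "m \<in> B" "\<And>s. s \<in> B \<Longrightarrow> (m, s) \<in> r"
proof -
  let ?D = "{s \<in> T. (s, t') \<in> r}"
  have "t' \<in> T" using assms r_in_T by blast
  then have "wf (Restr r ?D - Id)" using initial_wellorder unfolding order_on_defs by blast
  then obtain m where m: "m \<in> B" "\<And>s. (s, m) \<in> Restr r ?D - Id \<Longrightarrow> s \<notin> B"
    using assms(1) wfE_min[of "Restr r ?D - Id" t B] by blast
  have "(m, s) \<in> r" if "s \<in> B" for s
  proof (cases "s = m")
    case True
    then show ?thesis using m(1) assms(2) r_refl by blast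
  next
    case False
    then have "(s, m) \<notin> r" using m assms(2) that by blast
    then show ?thesis using r_total_below[of m t' s] m(1) assms(2) that by blast
  qed
  then show thesis using that m(1) by blast
qed

abbreviation "bel \<equiv> below T r"
abbreviation "top_nodes \<equiv> tops T r"
abbreviation "dc \<equiv> down_closed T r"
abbreviation "Rays \<equiv> rays T r"

lemma below_iff: "s \<in> bel t \<longleftrightarrow> (s, t) \<in> r \<and> s \<noteq> t"
  using r_in_T unfolding below_def by blast

text \<open>Were the nodes distinct, the smaller would be a strict predecessor of the larger and
  therefore of itself.\<close>

lemma below_eq_imp_eq:
  assumes "bel s = bel t" "(s, t) \<in> r \<or> (t, s) \<in> r"
  shows "s = t"
  using assms below_iff[of s t] below_iff[of t s] below_iff[of s s] below_iff[of t t] by auto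

lemma ray:
  assumes "R \<in> Rays"
  shows ray_subset: "R \<subseteq> T" and ray_down: "\<And>s t. t \<in> R \<Longrightarrow> (s, t) \<in> r \<Longrightarrow> s \<in> R"
    and ray_chain: "\<And>s t. s \<in> R \<Longrightarrow> t \<in> R \<Longrightarrow> (s, t) \<in> r \<or> (t, s) \<in> r"
    and ray_no_max: "\<And>m. m \<in> R \<Longrightarrow> \<exists>y\<in>R. (m, y) \<in> r \<and> y \<noteq> m"
    and root_in_ray: "root \<in> R"
proof -
  show T: "R \<subseteq> T" using assms unfolding rays_def by blast
  show d: "s \<in> R" if "t \<in> R" "(s, t) \<in> r" for s t
  proof -
    have "\<forall>t\<in>R. \<forall>s\<in>T. (s, t) \<in> r \<longrightarrow> s \<in> R" using assms unfolding rays_def by blast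
    then show ?thesis using that r_in_T by blast
  qed
  show "(s, t) \<in> r \<or> (t, s) \<in> r" if "s \<in> R" "t \<in> R" for s t
    using assms that unfolding rays_def Chains_def by blast
  show "\<exists>y\<in>R. (m, y) \<in> r \<and> y \<noteq> m" if "m \<in> R" for m
    using assms that unfolding rays_def no_maximal_def by blast
  have "R \<noteq> {}" using assms unfolding rays_def by blast
  then show "root \<in> R" using d root(2) T by blast
qed

text \<open>A maximal chain through \<open>t\<close> is a ray: by maximality it contains every node
  comparable with all its members, hence their predecessors and, as the tree is pruned, a node
  beyond any supposed last one.\<close>

lemma ray_through:
  assumes t: "t \<in> T"
  obtains R where "R \<in> Rays" "t \<in> R"
proof -
  let ?A = "{C. C \<subseteq> T \<and> t \<in> C \<and> C \<in> Chains r}"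
  have "\<exists>M\<in>?A. \<forall>C\<in>?A. M \<subseteq> C \<longrightarrow> C = M"
  proof (rule subset_Zorn_nonempty)
    show "?A \<noteq> {}" using t r_refl by (auto simp: Chains_def intro!: exI[of _ "{t}"])
    fix \<C> assume ne: "\<C> \<noteq> {}" and c: "subset.chain ?A \<C>"
    have sub: "\<C> \<subseteq> ?A" and lin: "\<And>C D. C \<in> \<C> \<Longrightarrow> D \<in> \<C> \<Longrightarrow> C \<subseteq> D \<or> D \<subseteq> C"
      using c unfolding subset.chain_def by auto
    have "(a, b) \<in> r \<or> (b, a) \<in> r" if ab: "a \<in> \<Union>\<C>" "b \<in> \<Union>\<C>" for a b
    proof -
      obtain C D where CD: "C \<in> \<C>" "D \<in> \<C>" "a \<in> C" "b \<in> D" using ab by blast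
      then obtain E where "E \<in> \<C>" "a \<in> E" "b \<in> E" using lin[OF CD(1,2)] by blast
      then show ?thesis using sub unfolding Chains_def by blast
    qed
    then show "\<Union>\<C> \<in> ?A" using sub ne unfolding Chains_def by blast
  qed
  then obtain M where MA: "M \<in> ?A" and "\<forall>C\<in>?A. M \<subseteq> C \<longrightarrow> C = M" by (rule bexE)
  then have max: "C = M" if "C \<in> ?A" "M \<subseteq> C" for C using that by blast
  have M: "M \<subseteq> T" "t \<in> M" "M \<in> Chains r" using MA by simp_all
  have ch: "(a, b) \<in> r \<or> (b, a) \<in> r" if "a \<in> M" "b \<in> M" for a b
    using M(3) that unfolding Chains_def by blast
  have add: "s \<in> M" if "s \<in> T" "\<And>m. m \<in> M \<Longrightarrow> (s, m) \<in> r \<or> (m, s) \<in> r" for s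
  proof -
    have "insert s M \<in> Chains r"
      using that(2) ch r_refl[OF that(1)] unfolding Chains_def by blast
    then have "insert s M = M" using M that(1) by (intro max) auto
    then show ?thesis by blast
  qed
  have "s \<in> M" if s: "m \<in> M" "s \<in> T" "(s, m) \<in> r" for m s
  proof (rule add[OF s(2)])
    fix m' assume m': "m' \<in> M"
    show "(s, m') \<in> r \<or> (m', s) \<in> r"
      using ch[OF s(1) m'] r_total_below[OF s(3), of m'] r_trans[OF s(3)] by blast
  qed
  moreover have "\<exists>y\<in>M. (m, y) \<in> r \<and> y \<noteq> m" if m: "m \<in> M" for m
  proof (rule ccontr)
    assume n: "\<not> (\<exists>y\<in>M. (m, y) \<in> r \<and> y \<noteq> m)"
    have le: "(y, m) \<in> r" if "y \<in> M" for y
      using ch[OF m that] n that m M(1) r_refl by blast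
    obtain s where s: "s \<in> T" "(m, s) \<in> r" "s \<noteq> m" using no_max m M(1) by blast
    have "s \<in> M" using add[OF s(1)] le r_trans[OF _ s(2)] by blast
    then show False using n s by blast
  qed
  ultimately have "M \<in> Rays"
    using M unfolding rays_def no_maximal_def by blast
  then show thesis using that M(2) by blast
qed

section \<open>The sets of points whose rays pass through a given node\<close>

definition A :: "'t \<Rightarrow> 'a set" where
  "A t = h ` {R \<in> Rays. t \<in> R}"

lemma h_image: "h ` Rays = topspace X" and h_inj: "inj_on h Rays"
  using homeo homeomorphic_imp_surjective_map homeomorphic_imp_injective_map
  by (metis topspace_ray_space)+

lemma h_mem_A: "R \<in> Rays \<Longrightarrow> h R \<in> A t \<longleftrightarrow> t \<in> R"
  using h_inj unfolding A_def inj_on_def by blast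

lemma openin_h_image: "W \<subseteq> Rays \<Longrightarrow> openin X (h ` W) \<longleftrightarrow> openin (ray_space T r) W"
  using homeomorphic_map_openness[OF homeo] by (simp add: topspace_ray_space)

lemma openin_h_basic:
  assumes "finite E" "finite F" "E \<subseteq> T" "F \<subseteq> T"
  shows "openin X (h ` {R \<in> Rays. E \<subseteq> R \<and> F \<inter> R = {}})"
proof -
  have "openin (ray_space T r) {R \<in> Rays. E \<subseteq> R \<and> F \<inter> R = {}}"
    unfolding openin_ray_space
  proof (intro conjI ballI)
    fix R assume R: "R \<in> {R \<in> Rays. E \<subseteq> R \<and> F \<inter> R = {}}"
    show "\<exists>E' F'. finite E' \<and> finite F' \<and> E' \<subseteq> R \<and> F' \<subseteq> T - R \<and>
        (\<forall>R'\<in>Rays. E' \<subseteq> R' \<and> F' \<inter> R' = {} \<longrightarrow> R' \<in> {R \<in> Rays. E \<subseteq> R \<and> F \<inter> R = {}})"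
      using R assms by (rule_tac x = E in exI, rule_tac x = F in exI) blast
  qed blast
  then show ?thesis by (subst openin_h_image) auto
qed

lemma openin_A: "t \<in> T \<Longrightarrow> openin X (A t)"
  using openin_h_basic[of "{t}" "{}"] unfolding A_def by simp

lemma A_nonempty: "t \<in> T \<Longrightarrow> A t \<noteq> {}"
  using ray_through unfolding A_def by blast

lemma A_root: "A root = topspace X"
  using root_in_ray h_image unfolding A_def by blast

lemma A_disjoint:
  assumes "bel s = bel t" "x \<in> A s" "x \<in> A t"
  shows "s = t"
proof -
  obtain R where R: "R \<in> Rays" "s \<in> R" "x = h R" using assms(2) unfolding A_def by blast
  then have "t \<in> R" using assms(3) h_mem_A by blast
  then have "(s, t) \<in> r \<or> (t, s) \<in> r" using ray_chain R by blast
  then show ?thesis by (rule below_eq_imp_eq[OF assms(1)])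
qed

text \<open>Every node lies on a ray, so disjointness makes \<open>A\<close> injective among nodes
  with the same predecessors. This is how a node is read off Bob's move.\<close>

lemma A_eq: "bel s = bel t \<Longrightarrow> s \<in> T \<Longrightarrow> A s = A t \<Longrightarrow> s = t"
  using A_disjoint A_nonempty by blast

text \<open>Take the least node up to \<open>t\<close> outside \<open>C\<close>: what is strictly
  below it is in \<open>C\<close> by minimality, and \<open>C\<close> is below it because
  \<open>C\<close> is down-closed and lies on the same chain under \<open>t\<close>.\<close>

lemma least_outside:
  assumes "dc C" "t \<in> T" "t \<notin> C" "\<And>c. c \<in> C \<Longrightarrow> (c, t) \<in> r"
  obtains s where "s \<in> top_nodes C" "(s, t) \<in> r"
proof -
  have "t \<in> {s \<in> T. (s, t) \<in> r} - C" using assms(2,3) r_refl by blast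
  then obtain s where s: "s \<in> {s \<in> T. (s, t) \<in> r} - C"
    "\<And>s'. s' \<in> {s \<in> T. (s, t) \<in> r} - C \<Longrightarrow> (s, s') \<in> r"
    using least_element[of t "{s \<in> T. (s, t) \<in> r} - C" t] by blast
  have "bel s = C"
  proof
    show "bel s \<subseteq> C"
    proof
      fix p assume p: "p \<in> bel s"
      then have "(p, t) \<in> r" using s(1) below_iff r_trans by blast
      then show "p \<in> C" using s(2)[of p] p below_iff r_antisym r_in_T by blast
    qed
    show "C \<subseteq> bel s"
    proof
      fix c assume c: "c \<in> C"
      then have "(c, s) \<in> r \<or> (s, c) \<in> r" using r_total_below assms(4) s(1) by blast
      moreover have "(s, c) \<notin> r" using s(1) c assms(1) unfolding down_closed_def by blast
      ultimately show "c \<in> bel s" using below_iff s(1) c by blast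
    qed
  qed
  then show thesis using that s(1) unfolding tops_def by blast
qed

lemma ray_top:
  assumes "dc C" "R \<in> Rays" "C \<subseteq> R" "C \<noteq> R"
  obtains s where "s \<in> top_nodes C" "s \<in> R"
proof -
  obtain t where t: "t \<in> R" "t \<notin> C" using assms by blast
  have "(c, t) \<in> r" if c: "c \<in> C" for c
  proof -
    have "(c, t) \<in> r \<or> (t, c) \<in> r" using ray_chain[OF assms(2)] assms(3) c t by blast
    then show ?thesis
      using assms(1) c t ray_subset[OF assms(2)] unfolding down_closed_def by blast
  qed
  then obtain s where "s \<in> top_nodes C" "(s, t) \<in> r"
    using least_outside[OF assms(1) _ t(2)] ray_subset[OF assms(2)] t by blast
  then show thesis using that ray_down[OF assms(2)] t by blast
qed

lemma top_node:
  assumes "s \<in> top_nodes C"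
  shows "s \<in> T" "bel s = C" "s \<notin> C" "\<And>R. R \<in> Rays \<Longrightarrow> s \<in> R \<Longrightarrow> C \<subseteq> R"
proof -
  show s: "s \<in> T" "bel s = C" using assms unfolding tops_def by auto
  then show "s \<notin> C" using below_iff by blast
  show "C \<subseteq> R" if "R \<in> Rays" "s \<in> R" for R using that s ray_down[of R s] below_iff by blast
qed

text \<open>A ray containing \<open>C\<close> either equals \<open>C\<close> or leaves it through a
  minimal node above it. The last term is empty unless \<open>C\<close> is itself a ray, so one
  equation yields both the partitions and the limit pairs.\<close>

lemma A_cover:
  assumes "dc C"
  shows "h ` {R \<in> Rays. C \<subseteq> R} = \<Union>(A ` top_nodes C) \<union> h ` ({C} \<inter> Rays)"
proof
  show "h ` {R \<in> Rays. C \<subseteq> R} \<subseteq> \<Union>(A ` top_nodes C) \<union> h ` ({C} \<inter> Rays)"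
  proof
    fix x assume "x \<in> h ` {R \<in> Rays. C \<subseteq> R}"
    then obtain R where R: "R \<in> Rays" "C \<subseteq> R" "x = h R" by blast
    show "x \<in> \<Union>(A ` top_nodes C) \<union> h ` ({C} \<inter> Rays)"
    proof (cases "C = R")
      case False
      then obtain s where "s \<in> top_nodes C" "s \<in> R" using ray_top assms R by blast
      then show ?thesis using R h_mem_A by blast
    qed (use R in blast)
  qed
  show "\<Union>(A ` top_nodes C) \<union> h ` ({C} \<inter> Rays) \<subseteq> h ` {R \<in> Rays. C \<subseteq> R}"
    using top_node(4) unfolding A_def by blast
qed

lemma A_tops_disjoint: "disjoint (A ` top_nodes C)"
proof (rule disjointI)
  fix U V assume "U \<in> A ` top_nodes C" "V \<in> A ` top_nodes C" "U \<noteq> V"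
  then obtain s t where st: "s \<in> top_nodes C" "t \<in> top_nodes C" "U = A s" "V = A t" "s \<noteq> t" by blast
  then have "bel s = bel t" using top_node(2) by metis
  then show "U \<inter> V = {}" using st A_disjoint by blast
qed

lemma A_tops:
  "{} \<notin> A ` top_nodes C" "V \<in> A ` top_nodes C \<Longrightarrow> openin X V"
  using A_nonempty openin_A top_node(1) by (auto, metis)

text \<open>A node with a single child has the same set of rays as that child, so a move of Bob does not
  determine a node by itself; it does together with the set of nodes below.\<close>
definition codes :: "('o::wellorder \<Rightarrow> 't) \<Rightarrow> ('o, 'a) bob_seq \<Rightarrow> bool" where
  "codes g u \<longleftrightarrow> is_seq u \<and>
     (\<forall>\<beta>\<in>dom u. g \<beta> \<in> T \<and> bel (g \<beta>) = insert root (g ` {..<\<beta>}) \<and> u \<beta> = Some (A (g \<beta>)))"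

text \<open>The root belongs to every position: the game starts on the whole space, which is
  \<open>A root\<close>, so inning 0 already moves to a child of the root.\<close>

definition nodes :: "('o \<Rightarrow> 't) \<Rightarrow> ('o, 'a) bob_seq \<Rightarrow> 't set" where
  "nodes g u = insert root (g ` dom u)"

section \<open>Sequences of moves read as branches of nodes\<close>

lemma codes:
  assumes "codes g u"
  shows codes_is_seq: "is_seq u"
    and codes_in: "\<And>\<beta>. \<beta> \<in> dom u \<Longrightarrow> g \<beta> \<in> T"
    and codes_below: "\<And>\<beta>. \<beta> \<in> dom u \<Longrightarrow> bel (g \<beta>) = insert root (g ` {..<\<beta>})"
    and codes_A: "\<And>\<beta>. \<beta> \<in> dom u \<Longrightarrow> u \<beta> = Some (A (g \<beta>))"
  using assms unfolding codes_def by auto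

lemma codes_mono:
  assumes "codes g u" "\<gamma> \<in> dom u"
  shows "\<beta> < \<gamma> \<Longrightarrow> g \<beta> \<in> bel (g \<gamma>)" "\<beta> \<le> \<gamma> \<Longrightarrow> (g \<beta>, g \<gamma>) \<in> r" "root \<in> bel (g \<gamma>)" "g \<gamma> \<noteq> root"
proof -
  show 1: "g \<beta> \<in> bel (g \<gamma>)" if "\<beta> < \<gamma>" for \<beta>
    using codes_below[OF assms] that by auto
  show "(g \<beta>, g \<gamma>) \<in> r" if "\<beta> \<le> \<gamma>"
  proof (cases "\<beta> = \<gamma>")
    case True
    then show ?thesis using r_refl codes_in[OF assms] by simp
  next
    case False
    then show ?thesis using 1[of \<beta>] that below_iff by simp
  qed
  show 2: "root \<in> bel (g \<gamma>)" using codes_below[OF assms] by auto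
  show "g \<gamma> \<noteq> root" using 2 below_iff by metis
qed

lemma codes_prefix:
  assumes "codes g v" "is_seq u" "u \<subseteq>\<^sub>m v"
  shows "codes g u"
  unfolding codes_def
proof (intro conjI ballI assms(2))
  fix \<beta> assume b: "\<beta> \<in> dom u"
  then have v: "\<beta> \<in> dom v" "u \<beta> = v \<beta>"
    using map_le_implies_dom_le[OF assms(3)] assms(3) by (blast, simp add: map_le_def)
  show "g \<beta> \<in> T" "bel (g \<beta>) = insert root (g ` {..<\<beta>})" "u \<beta> = Some (A (g \<beta>))"
    using codes_in[OF assms(1) v(1)] codes_below[OF assms(1) v(1)] codes_A[OF assms(1) v(1)] v(2)
    by simp_all
qed

lemma codes_restrict:
  assumes "codes g u"
  shows "codes g (u |` {..<\<beta>})" "codes g (u |` {..\<beta>})"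
  using codes_prefix[OF assms _ map_le_restrict] is_seq_restrict[OF codes_is_seq[OF assms]] by blast+

text \<open>Equal earlier nodes give equal predecessor sets, and for those the played set determines
  the node.\<close>

lemma codes_unique:
  assumes "codes g u" "codes g' u" "\<beta> \<in> dom u"
  shows "g \<beta> = g' \<beta>"
  using assms(3)
proof (induction \<beta> rule: less_induct)
  case (less \<beta>)
  have "\<gamma> \<in> dom u" if "\<gamma> < \<beta>" for \<gamma>
    using codes_is_seq[OF assms(1)] less.prems that unfolding is_seq_def by blast
  then have "g \<gamma> = g' \<gamma>" if "\<gamma> < \<beta>" for \<gamma> using less.IH that by blast
  then have "g ` {..<\<beta>} = g' ` {..<\<beta>}" by (intro image_cong) auto
  then have "bel (g \<beta>) = bel (g' \<beta>)"
    using codes_below[OF assms(1) less.prems] codes_below[OF assms(2) less.prems] by simp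
  moreover have "A (g \<beta>) = A (g' \<beta>)"
    using codes_A[OF assms(1) less.prems] codes_A[OF assms(2) less.prems] by simp
  ultimately show ?case using A_eq codes_in[OF assms(1) less.prems] by blast
qed

lemma nodes_down_closed:
  assumes "codes g u" shows "dc (nodes g u)"
  unfolding down_closed_def
proof (intro conjI ballI impI)
  show "nodes g u \<subseteq> T" using codes_in[OF assms] root(1) unfolding nodes_def by blast
  fix c s assume c: "c \<in> nodes g u" "s \<in> T" "(s, c) \<in> r"
  show "s \<in> nodes g u"
  proof (cases "c = root")
    case True
    then show ?thesis using c root r_antisym unfolding nodes_def by blast
  next
    case False
    then obtain \<beta> where b: "\<beta> \<in> dom u" "c = g \<beta>" using c(1) unfolding nodes_def by blast
    have "{..<\<beta>} \<subseteq> dom u" using initial_subset(1)[OF codes_is_seq[OF assms] b(1)] .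
    then have "bel c \<subseteq> nodes g u" using codes_below[OF assms b(1)] b(2) unfolding nodes_def by blast
    then show ?thesis using c b below_iff by (cases "s = c") blast+
  qed
qed

section \<open>The strategy that follows the branches of the tree\<close>

definition branch :: "('o::wellorder, 'a) bob_seq \<Rightarrow> 't set" where
  "branch u = nodes (SOME g. codes g u) u"

lemma branch_eq:
  assumes "codes g u" shows "branch u = nodes g u"
proof -
  have "codes (SOME g. codes g u) u" using assms by (rule someI[of "\<lambda>g. codes g u"])
  then have "(SOME g. codes g u) ` dom u = g ` dom u"
    using codes_unique[OF _ assms] by (intro image_cong) auto
  then show ?thesis unfolding branch_def nodes_def by simp
qed

text \<open>It is undefined off coded sequences because the domain of a strategy must consist
  exactly of the played sequences with a legal reply; \<open>played_codes\<close> and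
  \<open>codes_played\<close> show that the played ones are the coded ones.\<close>

definition tree_strategy :: "('o::wellorder, 'a) strategy" where
  "tree_strategy u =
     (if \<exists>g. codes g u
      then Some (if u = Map.empty \<or> (\<exists>\<beta>. dom u = {..\<beta>}) then Partition (A ` top_nodes (branch u))
                 else Limit (A ` top_nodes (branch u)) (h (branch u)))
      else None)"

lemma dom_tree_strategy: "u \<in> dom tree_strategy \<longleftrightarrow> (\<exists>g. codes g u)"
  by (simp add: domIff tree_strategy_def)

lemma offer_tree_strategy:
  assumes "codes g u"
  obtains m where "tree_strategy u = Some m" "offer m = A ` top_nodes (branch u)"
proof -
  have "\<exists>g. codes g u" using assms by blast
  then show thesis using that unfolding tree_strategy_def by auto
qed

lemma played_codes:
  assumes "codes g u" shows "played tree_strategy u"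
  unfolding played_def
proof (intro conjI ballI)
  show "is_seq u" using codes_is_seq[OF assms] .
  fix \<beta> assume b: "\<beta> \<in> dom u"
  have c: "codes g (u |` {..<\<beta>})" using codes_restrict[OF assms] by blast
  have "dom (u |` {..<\<beta>}) = {..<\<beta>}" using dom_restrict_initial(1)[OF codes_is_seq[OF assms] b] .
  then have "branch (u |` {..<\<beta>}) = bel (g \<beta>)"
    using branch_eq[OF c] codes_below[OF assms b] unfolding nodes_def by simp
  then have "g \<beta> \<in> top_nodes (branch (u |` {..<\<beta>}))"
    using codes_in[OF assms b] unfolding tops_def by simp
  moreover have "the (u \<beta>) = A (g \<beta>)" using codes_A[OF assms b] by simp
  moreover obtain m where "tree_strategy (u |` {..<\<beta>}) = Some m"
    "offer m = A ` top_nodes (branch (u |` {..<\<beta>}))"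
    using offer_tree_strategy[OF c] .
  ultimately show "\<exists>m. tree_strategy (u |` {..<\<beta>}) = Some m \<and> the (u \<beta>) \<in> offer m"
    by blast
qed

text \<open>For each played inning, the prefix before it has its own coding, since Alice replied to
  it. These must be merged: nodes chosen afresh from the single moves agree with every such coding,
  having equal predecessors and equal \<open>A\<close>.\<close>

lemma codes_played:
  assumes pl: "played tree_strategy u" obtains g where "codes g u"
proof -
  have seq: "is_seq u" using pl unfolding played_def by blast
  have step: "(\<exists>g. codes g (u |` {..<\<beta>})) \<and> (\<exists>s\<in>top_nodes (branch (u |` {..<\<beta>})). u \<beta> = Some (A s))"
    if b: "\<beta> \<in> dom u" for \<beta>
  proof -
    obtain m where m: "tree_strategy (u |` {..<\<beta>}) = Some m" "the (u \<beta>) \<in> offer m"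
      using pl b unfolding played_def by blast
    obtain g where g: "codes g (u |` {..<\<beta>})" using m(1) dom_tree_strategy by blast
    have "offer m = A ` top_nodes (branch (u |` {..<\<beta>}))"
      using offer_tree_strategy[OF g] m(1) by force
    then obtain s where "s \<in> top_nodes (branch (u |` {..<\<beta>}))" "the (u \<beta>) = A s" using m(2) by blast
    then show ?thesis using g b by (auto intro!: bexI[of _ s])
  qed
  define g where "g = (\<lambda>\<beta>. SOME s. s \<in> top_nodes (branch (u |` {..<\<beta>})) \<and> u \<beta> = Some (A s))"
  have g: "g \<beta> \<in> top_nodes (branch (u |` {..<\<beta>}))" "u \<beta> = Some (A (g \<beta>))" if b: "\<beta> \<in> dom u" for \<beta>
  proof -
    have "\<exists>s. s \<in> top_nodes (branch (u |` {..<\<beta>})) \<and> u \<beta> = Some (A s)" using step[OF b] by blast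
    then have "g \<beta> \<in> top_nodes (branch (u |` {..<\<beta>})) \<and> u \<beta> = Some (A (g \<beta>))"
      unfolding g_def by (rule someI_ex)
    then show "g \<beta> \<in> top_nodes (branch (u |` {..<\<beta>}))" "u \<beta> = Some (A (g \<beta>))" by auto
  qed
  have "branch (u |` {..<\<beta>}) = insert root (g ` {..<\<beta>})" if b: "\<beta> \<in> dom u" for \<beta>
  proof -
    obtain g' where g': "codes g' (u |` {..<\<beta>})" using step[OF b] by blast
    have d: "dom (u |` {..<\<beta>}) = {..<\<beta>}" using dom_restrict_initial(1)[OF seq b] .
    have "g' \<gamma> = g \<gamma>" if gb: "\<gamma> < \<beta>" for \<gamma>
    proof -
      have gu: "\<gamma> \<in> dom u" using seq b gb unfolding is_seq_def by blast
      have gd: "\<gamma> \<in> dom (u |` {..<\<beta>})" using d gb by simp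
      have c: "codes g' (u |` {..<\<gamma>})"
        using codes_restrict(1)[OF g', of \<gamma>] restrict_restrict_less[OF gb, of u] by simp
      have "branch (u |` {..<\<gamma>}) = insert root (g' ` {..<\<gamma>})"
        using branch_eq[OF c] dom_restrict_initial(1)[OF seq gu] unfolding nodes_def by simp
      then have "bel (g' \<gamma>) = bel (g \<gamma>)"
        using codes_below[OF g' gd] top_node(2)[OF g(1)[OF gu]] by simp
      moreover have "A (g' \<gamma>) = A (g \<gamma>)" using codes_A[OF g' gd] g(2)[OF gu] gb by simp
      ultimately show ?thesis using A_eq codes_in[OF g' gd] by blast
    qed
    then have "g' ` {..<\<beta>} = g ` {..<\<beta>}" by (intro image_cong) auto
    then show ?thesis using branch_eq[OF g'] d unfolding nodes_def by simp
  qed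
  then have "codes g u"
    using seq g top_node(1,2) unfolding codes_def by metis
  then show thesis using that by blast
qed

text \<open>A branch with greatest node \<open>m\<close> is no ray, and the rays containing it are
  those through \<open>m\<close>; so \<open>A_cover\<close> has no extra point and partitions
  \<open>A m\<close>. Here \<open>m\<close> is the root or the node of the last inning.\<close>

lemma legal_successor:
  assumes c: "codes g u" and u: "u = Map.empty \<or> (\<exists>\<beta>. dom u = {..\<beta>})"
  shows "legal_move X u (Partition (A ` top_nodes (branch u)))"
proof -
  have part: "open_partition X (A m) (A ` top_nodes (branch u))"
    if m: "m \<in> branch u" "\<And>s. s \<in> branch u \<Longrightarrow> (s, m) \<in> r" for m
  proof -
    have "branch u \<notin> Rays" using ray_no_max m r_antisym by blast
    moreover have "{R \<in> Rays. branch u \<subseteq> R} = {R \<in> Rays. m \<in> R}"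
      using m ray_down by blast
    ultimately have "A m = \<Union>(A ` top_nodes (branch u))"
      using A_cover[OF nodes_down_closed[OF c]] branch_eq[OF c] unfolding A_def[of m] by simp
    then show ?thesis
      using A_tops A_tops_disjoint unfolding open_partition_def partition_on_def by simp
  qed
  show ?thesis
  proof (cases "u = Map.empty")
    case True
    then have "branch u = {root}" using branch_eq[OF c] by (simp add: nodes_def)
    then have "open_partition X (A root) (A ` top_nodes (branch u))"
      using part r_refl[OF root(1)] by simp
    then show ?thesis using True A_root unfolding legal_move_def by simp
  next
    case False
    then obtain \<beta> where b: "dom u = {..\<beta>}" using u by blast
    then have bd: "\<beta> \<in> dom u" by simp
    have "open_partition X (A (g \<beta>)) (A ` top_nodes (branch u))"
    proof (rule part)
      show "g \<beta> \<in> branch u" using branch_eq[OF c] bd unfolding nodes_def by blast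
      fix s assume "s \<in> branch u"
      then have "s = root \<or> (\<exists>\<gamma>\<le>\<beta>. s = g \<gamma>)" using branch_eq[OF c] b unfolding nodes_def by blast
      then show "(s, g \<beta>) \<in> r" using codes_mono(2)[OF c bd] root(2) codes_in[OF c bd] by blast
    qed
    then have "open_partition X (the (u \<beta>)) (A ` top_nodes (branch u))" using codes_A[OF c bd] by simp
    then show ?thesis using b False unfolding legal_move_def by auto
  qed
qed

lemma branch_ray:
  assumes c: "codes g u" and u: "u \<noteq> Map.empty" "\<nexists>\<beta>. dom u = {..\<beta>}"
  shows "branch u \<in> Rays" "\<And>\<beta>. \<beta> \<in> dom u \<Longrightarrow> \<exists>\<gamma>\<in>dom u. \<beta> < \<gamma>"
proof -
  show ex: "\<exists>\<gamma>\<in>dom u. \<beta> < \<gamma>" if b: "\<beta> \<in> dom u" for \<beta>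
  proof (rule ccontr)
    assume "\<not> (\<exists>\<gamma>\<in>dom u. \<beta> < \<gamma>)"
    then have "dom u \<subseteq> {..\<beta>}" by (auto simp: not_less)
    then have "dom u = {..\<beta>}" using initial_subset(2)[OF codes_is_seq[OF c] b] by blast
    then show False using u(2) by blast
  qed
  have br: "branch u = insert root (g ` dom u)" using branch_eq[OF c] unfolding nodes_def .
  have dc: "dc (branch u)" using nodes_down_closed[OF c] branch_eq[OF c] by simp
  obtain \<beta>0 where b0: "\<beta>0 \<in> dom u" using u(1) by fastforce
  have "\<exists>y\<in>branch u. (m, y) \<in> r \<and> y \<noteq> m" if m: "m \<in> branch u" for m
  proof (cases "m = root")
    case True
    have "(root, g \<beta>0) \<in> r" "root \<noteq> g \<beta>0" using codes_mono(3)[OF c b0] below_iff by simp_all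
    then show ?thesis using True b0 br by auto
  next
    case False
    then obtain \<beta> where b: "\<beta> \<in> dom u" "m = g \<beta>" using m br by blast
    obtain \<gamma> where g: "\<gamma> \<in> dom u" "\<beta> < \<gamma>" using ex[OF b(1)] by blast
    have "(g \<beta>, g \<gamma>) \<in> r" "g \<beta> \<noteq> g \<gamma>" using codes_mono(1)[OF c g] below_iff by simp_all
    then show ?thesis using b(2) g(1) br by auto
  qed
  moreover have "(s, t) \<in> r \<or> (t, s) \<in> r" if st: "s \<in> branch u" "t \<in> branch u" for s t
  proof (cases "s = root \<or> t = root")
    case True
    then show ?thesis using root(2) st dc unfolding down_closed_def by blast
  next
    case False
    then obtain \<beta> \<gamma> where "\<beta> \<in> dom u" "s = g \<beta>" "\<gamma> \<in> dom u" "t = g \<gamma>" using st br by blast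
    then show ?thesis
      using codes_mono(2)[OF c, of \<gamma> \<beta>] codes_mono(2)[OF c, of \<beta> \<gamma>] linear[of \<beta> \<gamma>] by auto
  qed
  moreover have "branch u \<noteq> {}" using br by blast
  ultimately show "branch u \<in> Rays"
    using dc unfolding rays_def no_maximal_def Chains_def down_closed_def by simp
qed

text \<open>The branch is now a ray, so \<open>A_cover\<close> supplies Alice's point. For the local
  basis, a finite condition satisfied by the branch must be implied by one earlier move together
  with the removal of finitely many offered sets.\<close>

lemma legal_limit:
  assumes c: "codes g u" and u: "u \<noteq> Map.empty" "\<nexists>\<beta>. dom u = {..\<beta>}"
  shows "limit_pair X u (A ` top_nodes (branch u)) (h (branch u))"
proof -
  let ?C = "branch u" and ?P = "A ` top_nodes (branch u)"
  have br: "?C = insert root (g ` dom u)" using branch_eq[OF c] unfolding nodes_def .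
  have dc: "dc ?C" using nodes_down_closed[OF c] branch_eq[OF c] by simp
  have ray: "?C \<in> Rays" using branch_ray(1)[OF c u] .
  have ranu: "ran u = (\<lambda>\<beta>. A (g \<beta>)) ` dom u"
  proof
    show "ran u \<subseteq> (\<lambda>\<beta>. A (g \<beta>)) ` dom u" using codes_A[OF c] unfolding ran_def by force
    show "(\<lambda>\<beta>. A (g \<beta>)) ` dom u \<subseteq> ran u" using codes_A[OF c] unfolding ran_def by blast
  qed
  obtain \<beta>0 where b0: "\<beta>0 \<in> dom u" using u(1) by fastforce
  have inter: "\<Inter>(ran u) = h ` {R \<in> Rays. ?C \<subseteq> R}"
  proof
    show "\<Inter>(ran u) \<subseteq> h ` {R \<in> Rays. ?C \<subseteq> R}"
    proof
      fix x assume x: "x \<in> \<Inter>(ran u)"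
      then have "x \<in> A (g \<beta>0)" using ranu b0 by blast
      then obtain R where R: "R \<in> Rays" "x = h R" unfolding A_def by blast
      have "g \<beta> \<in> R" if "\<beta> \<in> dom u" for \<beta> using x ranu that R h_mem_A by blast
      then have "?C \<subseteq> R" unfolding br using root_in_ray[OF R(1)] by blast
      then show "x \<in> h ` {R \<in> Rays. ?C \<subseteq> R}" using R by blast
    qed
    show "h ` {R \<in> Rays. ?C \<subseteq> R} \<subseteq> \<Inter>(ran u)"
    proof (intro subsetI InterI)
      fix x U assume "x \<in> h ` {R \<in> Rays. ?C \<subseteq> R}" "U \<in> ran u"
      then obtain R \<beta> where R: "R \<in> Rays" "?C \<subseteq> R" "x = h R" "\<beta> \<in> dom u" "U = A (g \<beta>)"
        unfolding ranu by blast
      then have "g \<beta> \<in> R" unfolding br by blast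
      then show "x \<in> U" using R h_mem_A[OF R(1)] by simp
    qed
  qed
  have hC: "h ?C \<notin> \<Union>?P" using h_mem_A[OF ray] top_node(3) by blast
  have "local_basis_at X (h ?C) {U - \<Union>F | U F. U \<in> ran u \<and> finite F \<and> F \<subseteq> ?P}"
    unfolding local_basis_at_def
  proof (intro conjI ballI allI impI)
    fix V assume "V \<in> {U - \<Union>F | U F. U \<in> ran u \<and> finite F \<and> F \<subseteq> ?P}"
    then obtain U F where V: "V = U - \<Union>F" "U \<in> ran u" "finite F" "F \<subseteq> ?P" by blast
    obtain \<beta> where b: "\<beta> \<in> dom u" "U = A (g \<beta>)" using V(2) ranu by blast
    obtain G where G: "G \<subseteq> top_nodes ?C" "finite G" "F = A ` G"
      using finite_subset_image[OF V(3,4)] by blast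
    have "V = h ` {R \<in> Rays. {g \<beta>} \<subseteq> R \<and> G \<inter> R = {}}"
    proof
      show "V \<subseteq> h ` {R \<in> Rays. {g \<beta>} \<subseteq> R \<and> G \<inter> R = {}}"
      proof
        fix x assume x: "x \<in> V"
        then obtain R where R: "R \<in> Rays" "g \<beta> \<in> R" "x = h R" using V(1) b(2) unfolding A_def by blast
        have "G \<inter> R = {}" using x V(1) G(3) h_mem_A[OF R(1)] R(3) by blast
        then show "x \<in> h ` {R \<in> Rays. {g \<beta>} \<subseteq> R \<and> G \<inter> R = {}}" using R by blast
      qed
      show "h ` {R \<in> Rays. {g \<beta>} \<subseteq> R \<and> G \<inter> R = {}} \<subseteq> V"
      proof
        fix x assume "x \<in> h ` {R \<in> Rays. {g \<beta>} \<subseteq> R \<and> G \<inter> R = {}}"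
        then obtain R where R: "R \<in> Rays" "g \<beta> \<in> R" "G \<inter> R = {}" "x = h R" by blast
        then show "x \<in> V" using V(1) b(2) G(3) h_mem_A[OF R(1)] by blast
      qed
    qed
    moreover have "G \<subseteq> T" using G(1) top_node(1) by blast
    ultimately show "openin X V"
      using openin_h_basic[of "{g \<beta>}" G] G(2) codes_in[OF c b(1)] by simp
    have "h ?C \<in> U" using b br h_mem_A[OF ray] by blast
    then show "h ?C \<in> V" using V(1,4) hC by blast
  next
    fix W assume W: "openin X W \<and> h ?C \<in> W"
    let ?W = "{R \<in> Rays. h R \<in> W}"
    have "openin (ray_space T r) ?W"
      using openin_continuous_map_preimage[OF homeomorphic_imp_continuous_map[OF homeo]] W
      by (simp add: topspace_ray_space)
    moreover have "?C \<in> ?W" using ray W by blast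
    ultimately obtain E F where EF: "finite E" "finite F" "E \<subseteq> ?C" "F \<subseteq> T - ?C"
      "\<And>R'. R' \<in> Rays \<Longrightarrow> E \<subseteq> R' \<Longrightarrow> F \<inter> R' = {} \<Longrightarrow> R' \<in> ?W"
      unfolding openin_ray_space by meson
    \<comment> \<open>Two kinds of forbidden nodes: if \<open>f\<close> is above the whole branch,
      forbidding the minimal node \<open>top f\<close> under it forbids \<open>f\<close>. Otherwise
      some branch node \<open>out f\<close> is not below \<open>f\<close>; a ray through both would
      have \<open>f\<close> below \<open>out f\<close>, hence in the branch, so requiring
      \<open>out f\<close> forbids \<open>f\<close>.\<close>
    let ?up = "\<lambda>f. \<forall>c\<in>?C. (c, f) \<in> r"
    define top where "top f = (SOME s. s \<in> top_nodes ?C \<and> (s, f) \<in> r)" for f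
    define out where "out f = (SOME x. x \<in> ?C \<and> (x, f) \<notin> r)" for f
    have top: "top f \<in> top_nodes ?C" "(top f, f) \<in> r" if f: "f \<in> F" "?up f" for f
    proof -
      have "f \<in> T" "f \<notin> ?C" using f(1) EF(4) by blast+
      then have "\<exists>s. s \<in> top_nodes ?C \<and> (s, f) \<in> r" using least_outside[OF dc, of f] f(2) by blast
      then have "top f \<in> top_nodes ?C \<and> (top f, f) \<in> r" unfolding top_def by (rule someI_ex)
      then show "top f \<in> top_nodes ?C" "(top f, f) \<in> r" by auto
    qed
    have out: "out f \<in> ?C" "(out f, f) \<notin> r" if f: "\<not> ?up f" for f
    proof -
      have "\<exists>x. x \<in> ?C \<and> (x, f) \<notin> r" using f by blast
      then have "out f \<in> ?C \<and> (out f, f) \<notin> r" unfolding out_def by (rule someI_ex)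
      then show "out f \<in> ?C" "(out f, f) \<notin> r" by auto
    qed
    \<comment> \<open>Finitely many branch nodes lie below one played node, so all requirements
      reduce to a single set \<open>A (g \<beta>)\<close>.\<close>
    have bound: "\<exists>\<beta>\<in>dom u. \<forall>e\<in>E'. (e, g \<beta>) \<in> r" if E': "finite E'" "E' \<subseteq> ?C" for E'
      using E'
    proof (induction E' rule: finite_induct)
      case empty
      then show ?case using b0 by blast
    next
      case (insert e E')
      then obtain \<beta> where b: "\<beta> \<in> dom u" "\<forall>e\<in>E'. (e, g \<beta>) \<in> r" by blast
      show ?case
      proof (cases "e = root")
        case True
        then show ?thesis using b root(2) codes_in[OF c b(1)] by blast
      next
        case False
        then obtain \<gamma> where g: "\<gamma> \<in> dom u" "e = g \<gamma>" using insert.prems br by blast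
        show ?thesis
        proof (cases "\<gamma> \<le> \<beta>")
          case True
          then show ?thesis using codes_mono(2)[OF c b(1) True] b g by blast
        next
          case False
          then have "(g \<beta>, g \<gamma>) \<in> r" using codes_mono(2)[OF c g(1)] by simp
          then show ?thesis using b g r_trans r_refl[OF codes_in[OF c g(1)]] by blast
        qed
      qed
    qed
    let ?E = "E \<union> out ` {f\<in>F. \<not> ?up f}"
    have "finite ?E" "?E \<subseteq> ?C"
      using EF(1,2,3) out(1) by auto
    then have "\<exists>\<beta>\<in>dom u. \<forall>e\<in>?E. (e, g \<beta>) \<in> r" by (rule bound)
    then obtain \<beta> where b: "\<beta> \<in> dom u" "\<forall>e\<in>?E. (e, g \<beta>) \<in> r" by (rule bexE)
    let ?G = "top ` {f\<in>F. ?up f}"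
    have "A (g \<beta>) - \<Union>(A ` ?G) \<subseteq> W"
    proof
      fix x assume x: "x \<in> A (g \<beta>) - \<Union>(A ` ?G)"
      then obtain R where R: "R \<in> Rays" "g \<beta> \<in> R" "x = h R" unfolding A_def by blast
      have in_R: "e \<in> R" if "e \<in> ?E" for e
        using bspec[OF b(2) that] by (rule ray_down[OF R(1,2)])
      have "f \<notin> R" if f: "f \<in> F" for f
      proof
        assume fR: "f \<in> R"
        show False
        proof (cases "?up f")
          case True
          then have "top f \<in> R" using top(2)[OF f True] ray_down[OF R(1) fR] by blast
          then have "x \<in> A (top f)" using h_mem_A[OF R(1)] R(3) by simp
          then show False using x f True by blast
        next
          case False
          then have "out f \<in> R" using in_R f by blast
          then have "(f, out f) \<in> r" using ray_chain[OF R(1) fR] out(2)[OF False] by blast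
          then have "f \<in> ?C" using out(1)[OF False] dc f EF(4) unfolding down_closed_def by blast
          then show False using f EF(4) by blast
        qed
      qed
      then have "R \<in> ?W" using EF(5)[OF R(1)] in_R by blast
      then show "x \<in> W" using R(3) by blast
    qed
    moreover have "A (g \<beta>) \<in> ran u" using ranu b(1) by blast
    moreover have "finite (A ` ?G)" using EF(2) by simp
    moreover have "A ` ?G \<subseteq> ?P" using top(1) by blast
    ultimately show "\<exists>V\<in>{U - \<Union>F | U F. U \<in> ran u \<and> finite F \<and> F \<subseteq> ?P}. V \<subseteq> W" by blast
  qed
  moreover have "\<Inter>(ran u) = \<Union>?P \<union> {h ?C}" using inter A_cover[OF dc] ray by simp
  moreover have "h ?C \<in> topspace X" using h_image ray by blast
  ultimately show ?thesis
    using hC A_tops A_tops_disjoint unfolding limit_pair_def by simp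
qed

lemma legal_tree_strategy:
  assumes "codes g u" shows "legal_move X u (the (tree_strategy u))"
proof (cases "u = Map.empty \<or> (\<exists>\<beta>. dom u = {..\<beta>})")
  case True
  then have "tree_strategy u = Some (Partition (A ` top_nodes (branch u)))"
    using assms unfolding tree_strategy_def by auto
  then show ?thesis using legal_successor[OF assms True] by simp
next
  case False
  then have "tree_strategy u = Some (Limit (A ` top_nodes (branch u)) (h (branch u)))"
    using assms unfolding tree_strategy_def by auto
  then show ?thesis using legal_limit[OF assms] False unfolding legal_move_def by simp
qed

lemma alice_tree_strategy: "alice_strategy X tree_strategy"
  unfolding alice_strategy_def
proof
  show "dom tree_strategy = {u. played tree_strategy u \<and> (\<exists>m. legal_move X u m)}"
  proof (intro equalityI subsetI)
    fix u :: "('o::wellorder, 'a) bob_seq" assume "u \<in> dom tree_strategy"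
    then obtain g where g: "codes g u" using dom_tree_strategy by blast
    then show "u \<in> {u. played tree_strategy u \<and> (\<exists>m. legal_move X u m)}"
      using played_codes legal_tree_strategy by blast
  next
    fix u :: "('o::wellorder, 'a) bob_seq"
    assume "u \<in> {u. played tree_strategy u \<and> (\<exists>m. legal_move X u m)}"
    then obtain g where "codes g u" using codes_played by blast
    then show "u \<in> dom tree_strategy" using dom_tree_strategy by blast
  qed
  show "\<forall>u\<in>dom tree_strategy. legal_move X u (the (tree_strategy u))"
    using legal_tree_strategy dom_tree_strategy by blast
qed

lemma winning_tree_strategy: "winning_strategy X tree_strategy"
  unfolding winning_strategy_def
proof (intro conjI allI impI alice_tree_strategy)
  fix u :: "('o::wellorder, 'a) bob_seq" assume f: "finished_run X tree_strategy u"
  then obtain g where "codes g u" using codes_played unfolding finished_run_def by blast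
  then have "\<not> bob_wins X u" using legal_tree_strategy unfolding bob_wins_def by blast
  then show "alice_wins tree_strategy u" using f unfolding finished_run_def by blast
qed

section \<open>The isomorphism between sequences of successor length and nodes\<close>

abbreviation "S \<equiv> succ_seqs (dom (tree_strategy :: ('a inning, 'a) strategy))"

lemma S_iff: "u \<in> S \<longleftrightarrow> u = Map.empty \<or> (\<exists>g \<beta>. codes g u \<and> dom u = {..\<beta>})"
  unfolding succ_seqs_def using dom_tree_strategy[of u] by blast

definition node :: "('a inning, 'a) bob_seq \<Rightarrow> 't" where
  "node u = (if u = Map.empty then root else (SOME g. codes g u) (SOME \<beta>. dom u = {..\<beta>}))"

lemma node_eq:
  assumes "codes g u" "dom u = {..\<beta>}" shows "node u = g \<beta>"
proof -
  have "u \<noteq> Map.empty" using assms(2) by auto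
  moreover have "(SOME \<beta>. dom u = {..\<beta>}) = \<beta>"
    using assms(2) by (intro some_equality) auto
  moreover have "codes (SOME g. codes g u) u" using assms(1) by (rule someI[of "\<lambda>g. codes g u"])
  then have "(SOME g. codes g u) \<beta> = g \<beta>" using codes_unique[OF _ assms(1)] assms(2) by simp
  ultimately show ?thesis unfolding node_def by simp
qed

text \<open>A node determines its history: its predecessors form a chain, along which two codings
  cannot diverge. If the innings differed, the later coding would list the node as a strict
  predecessor of itself.\<close>

lemma codes_meet:
  assumes u: "codes g u" "\<beta> \<in> dom u" and v: "codes g' v" "\<gamma> \<in> dom v" and eq: "g \<beta> = g' \<gamma>"
  shows "\<beta> = \<gamma>" "\<And>\<delta>. \<delta> \<le> \<beta> \<Longrightarrow> g \<delta> = g' \<delta>"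
proof -
  have agree: "g \<delta> = g' \<delta>" if "\<delta> \<le> \<beta>" "\<delta> \<le> \<gamma>" for \<delta>
    using that
  proof (induction \<delta> rule: less_induct)
    case (less \<delta>)
    have d: "\<delta> \<in> dom u" "\<delta> \<in> dom v"
      using less.prems initial_subset(2)[OF codes_is_seq[OF u(1)] u(2)]
        initial_subset(2)[OF codes_is_seq[OF v(1)] v(2)] by auto
    have "g ` {..<\<delta>} = g' ` {..<\<delta>}" using less by (intro image_cong) auto
    then have b: "bel (g \<delta>) = bel (g' \<delta>)"
      using codes_below[OF u(1) d(1)] codes_below[OF v(1) d(2)] by simp
    have "(g \<delta>, g \<beta>) \<in> r" "(g' \<delta>, g \<beta>) \<in> r"
      using codes_mono(2)[OF u less.prems(1)] codes_mono(2)[OF v less.prems(2)] eq by simp_all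
    then have "(g \<delta>, g' \<delta>) \<in> r \<or> (g' \<delta>, g \<delta>) \<in> r" by (rule r_total_below)
    then show ?case using below_eq_imp_eq[OF b] by blast
  qed
  show bg: "\<beta> = \<gamma>"
  proof (rule ccontr)
    assume "\<beta> \<noteq> \<gamma>"
    then consider "\<beta> < \<gamma>" | "\<gamma> < \<beta>" by (rule linorder_neqE)
    then show False
    proof cases
      case 1
      then have "g' \<beta> \<in> bel (g' \<gamma>)" using codes_mono(1)[OF v] by blast
      then show False using agree[of \<beta>] 1 eq below_iff by simp
    next
      case 2
      then have "g \<gamma> \<in> bel (g \<beta>)" using codes_mono(1)[OF u] by blast
      then show False using agree[of \<gamma>] 2 eq below_iff by simp
    qed
  qed
  show "g \<delta> = g' \<delta>" if "\<delta> \<le> \<beta>" for \<delta> using agree that bg by simp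
qed

lemma node_in_T: "u \<in> S \<Longrightarrow> node u \<in> T"
  unfolding S_iff using node_eq codes_in root(1) node_def by fastforce

text \<open>Forward, a coding of \<open>v\<close> also codes its prefix \<open>u\<close>. Backward,
  a node below \<open>node v\<close> is the root or was played in \<open>v\<close>, and
  \<open>codes_meet\<close> makes the histories agree.\<close>

lemma node_le_iff:
  assumes "u \<in> S" "v \<in> S"
  shows "u \<subseteq>\<^sub>m v \<longleftrightarrow> (node u, node v) \<in> r"
proof (cases "u = Map.empty")
  case True
  then show ?thesis using root(2) node_in_T[OF assms(2)] by (simp add: node_def)
next
  case False
  then obtain g \<beta> where g: "codes g u" "dom u = {..\<beta>}" using assms(1) S_iff by blast
  have bu: "\<beta> \<in> dom u" using g(2) by simp
  have nu: "node u = g \<beta>" using node_eq[OF g] .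
  show ?thesis
  proof (cases "v = Map.empty")
    case True
    have "\<not> u \<subseteq>\<^sub>m v" using False True map_le_implies_dom_le[of u v] by auto
    moreover have "(g \<beta>, root) \<notin> r"
      using codes_mono(4)[OF g(1) bu] root(2)[OF codes_in[OF g(1) bu]] r_antisym by blast
    ultimately show ?thesis using nu True by (simp add: node_def)
  next
    case False
    then obtain g' \<gamma> where g': "codes g' v" "dom v = {..\<gamma>}" using assms(2) S_iff by blast
    have gv: "\<gamma> \<in> dom v" using g'(2) by simp
    have nv: "node v = g' \<gamma>" using node_eq[OF g'] .
    show ?thesis
    proof
      assume le: "u \<subseteq>\<^sub>m v"
      have "codes g' u" using codes_prefix[OF g'(1) codes_is_seq[OF g(1)] le] .
      then have "node u = g' \<beta>" using node_eq g(2) by blast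
      moreover have "\<beta> \<le> \<gamma>" using map_le_implies_dom_le[OF le] g(2) g'(2) by auto
      ultimately show "(node u, node v) \<in> r" using codes_mono(2)[OF g'(1) gv] nv by simp
    next
      assume "(node u, node v) \<in> r"
      then have "(g \<beta>, g' \<gamma>) \<in> r" using nu nv by simp
      then have "g \<beta> = g' \<gamma> \<or> g \<beta> \<in> insert root (g' ` {..<\<gamma>})"
        using codes_below[OF g'(1) gv] below_iff by blast
      then obtain \<delta> where d: "\<delta> \<le> \<gamma>" "g \<beta> = g' \<delta>"
        using codes_mono(4)[OF g(1) bu] by (auto intro: less_imp_le)
      then have dv: "\<delta> \<in> dom v" using g'(2) by simp
      note m = codes_meet[OF g(1) bu g'(1) dv d(2)]
      show "u \<subseteq>\<^sub>m v"
        unfolding map_le_def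
      proof
        fix \<epsilon> assume e: "\<epsilon> \<in> dom u"
        then have "\<epsilon> \<le> \<beta>" using g(2) by simp
        moreover from this have "\<epsilon> \<in> dom v" using g'(2) d(1) m(1) by auto
        ultimately show "u \<epsilon> = v \<epsilon>" using codes_A[OF g(1) e] codes_A[OF g'(1)] m(2) by metis
      qed
    qed
  qed
qed

text \<open>Climb towards \<open>t\<close> by recursion on innings, each time taking a node up to
  \<open>t\<close> whose predecessors are exactly the root and the nodes reached so far. The climb
  ends before the innings run out, and by \<open>least_outside\<close> it cannot end before
  \<open>t\<close> is reached.\<close>

lemma node_surj:
  assumes t: "t \<in> T" obtains u where "u \<in> S" "node u = t"
proof (cases "t = root")
  case True
  then show thesis using that[of Map.empty] S_iff by (simp add: node_def)
next
  case False
  let ?Q = "\<lambda>(e :: 'a inning \<Rightarrow> 't) \<beta> s. s \<in> T \<and> (s, t) \<in> r \<and> bel s = insert root (e ` {..<\<beta>})"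
  define e where "e = wfrec {(x, y :: 'a inning). x < y} (\<lambda>e \<beta>. SOME s. ?Q e \<beta> s)"
  have e: "e \<beta> = (SOME s. ?Q e \<beta> s)" for \<beta>
  proof -
    have "cut e {(x, y). x < y} \<beta> ` {..<\<beta>} = e ` {..<\<beta>}"
      by (intro image_cong) (auto simp: cut_apply)
    then show ?thesis
      using wfrec[OF wf, of "\<lambda>e \<beta>. SOME s. ?Q e \<beta> s" \<beta>] unfolding e_def by simp
  qed
  \<comment> \<open>\<open>SOME\<close> gives an arbitrary value once no candidate is left, so the
    sequence is cut where the choice first fails; asking for success at all \<gamma> \<le> \<beta>
    keeps the domain initial.\<close>
  define u where "u = (\<lambda>\<beta>. if \<forall>\<gamma>\<le>\<beta>. ?Q e \<gamma> (e \<gamma>) then Some (A (e \<beta>)) else None)"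
  have du: "\<beta> \<in> dom u \<longleftrightarrow> (\<forall>\<gamma>\<le>\<beta>. ?Q e \<gamma> (e \<gamma>))" for \<beta> unfolding u_def by (simp add: domIff)
  have c: "codes e u"
    unfolding codes_def
  proof (intro conjI ballI)
    show "is_seq u" unfolding is_seq_def using du by (meson order_trans less_imp_le)
    fix \<beta> assume b: "\<beta> \<in> dom u"
    then have "?Q e \<beta> (e \<beta>)" using du by blast
    then show "e \<beta> \<in> T" "bel (e \<beta>) = insert root (e ` {..<\<beta>})" by auto
    show "u \<beta> = Some (A (e \<beta>))" using b du unfolding u_def by simp
  qed
  \<comment> \<open>The node type is arbitrary, yet the climb is a play on \<open>X\<close> against
    \<open>tree_strategy\<close>, hence too short to exhaust the innings.\<close>
  obtain \<alpha> where a: "dom u = {..<\<alpha>}"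
    using is_seq_dom[OF codes_is_seq[OF c] played_not_UNIV[OF alice_tree_strategy played_codes[OF c]]] .
  have nu: "nodes e u = insert root (e ` {..<\<alpha>})" using a unfolding nodes_def by simp
  have "t \<in> nodes e u"
  proof (rule ccontr)
    assume tn: "t \<notin> nodes e u"
    have "(s, t) \<in> r" if "s \<in> nodes e u" for s
      using that root(2)[OF t] du unfolding nodes_def by blast
    then obtain s where s: "s \<in> top_nodes (nodes e u)" "(s, t) \<in> r"
      using least_outside[OF nodes_down_closed[OF c] t tn] by blast
    then have "?Q e \<alpha> s" using nu unfolding tops_def by simp
    then have "?Q e \<alpha> (e \<alpha>)" unfolding e[of \<alpha>] by (rule someI)
    moreover have "?Q e \<gamma> (e \<gamma>)" if "\<gamma> < \<alpha>" for \<gamma>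
    proof -
      have "\<gamma> \<in> dom u" using a that by simp
      then show ?thesis using du by blast
    qed
    ultimately have "\<alpha> \<in> dom u" unfolding du by (metis le_less)
    then show False using a by simp
  qed
  then obtain \<beta> where b: "\<beta> \<in> dom u" "t = e \<beta>" using False unfolding nodes_def by blast
  have cb: "codes e (u |` {..\<beta>})" and db: "dom (u |` {..\<beta>}) = {..\<beta>}"
    using codes_restrict[OF c] dom_restrict_initial(2)[OF codes_is_seq[OF c] b(1)] by blast+
  show thesis
  proof (rule that)
    show "u |` {..\<beta>} \<in> S" using S_iff cb db by blast
    show "node (u |` {..\<beta>}) = t" using node_eq[OF cb db] b(2) by simp
  qed
qed

lemma order_isomorphic_S: "order_isomorphic T r S (ext_order S)"
proof -
  have inj: "inj_on node S"
  proof (rule inj_onI)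
    fix u v assume uv: "u \<in> S" "v \<in> S" "node u = node v"
    then have "(node u, node v) \<in> r" "(node v, node u) \<in> r" using r_refl node_in_T by simp_all
    then show "u = v" using uv node_le_iff map_le_antisym by blast
  qed
  have im: "node ` S = T" using node_in_T node_surj by blast
  have "bij_betw node S T" using inj im by (simp add: bij_betw_def)
  then have "bij_betw (inv_into S node) T S" by (rule bij_betw_inv_into)
  moreover have "(s, t) \<in> r \<longleftrightarrow> (inv_into S node s, inv_into S node t) \<in> ext_order S"
    if "s \<in> T" "t \<in> T" for s t
  proof -
    have st: "s \<in> node ` S" "t \<in> node ` S" using that im by auto
    have "inv_into S node s \<subseteq>\<^sub>m inv_into S node t \<longleftrightarrow> (s, t) \<in> r"
      using node_le_iff[OF inv_into_into[OF st(1)] inv_into_into[OF st(2)]]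
        f_inv_into_f[OF st(1)] f_inv_into_f[OF st(2)] by simp
    then show ?thesis using inv_into_into[OF st(1)] inv_into_into[OF st(2)]
      unfolding ext_order_def by simp
  qed
  ultimately show ?thesis unfolding order_isomorphic_def by blast
qed

end

theorem theorem3p15:
  fixes X :: "'a topology"
  assumes "topspace X \<noteq> {}"
  shows "(\<forall>\<sigma> \<in> winning_strategies X.
            pruned_tree (succ_seqs (dom \<sigma>)) (ext_order (succ_seqs (dom \<sigma>))) \<and>
            ray_space (succ_seqs (dom \<sigma>)) (ext_order (succ_seqs (dom \<sigma>))) homeomorphic_space X) \<and>
         (\<forall>(T :: 't set) r. pruned_tree T r \<and> ray_space T r homeomorphic_space X \<longrightarrow>
            (\<exists>\<sigma> \<in> winning_strategies X.
               order_isomorphic T r (succ_seqs (dom \<sigma>)) (ext_order (succ_seqs (dom \<sigma>)))))"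
proof (intro conjI ballI allI impI)
  fix \<sigma> assume "\<sigma> \<in> winning_strategies X"
  then interpret winning_play X \<sigma>
    using assms by unfold_locales (auto simp: winning_strategies_def)
  show "pruned_tree (succ_seqs (dom \<sigma>)) (ext_order (succ_seqs (dom \<sigma>)))" by (rule pruned_tree_S)
  show "ray_space (succ_seqs (dom \<sigma>)) (ext_order (succ_seqs (dom \<sigma>))) homeomorphic_space X"
    using homeomorphic_map_imp_homeomorphic_space[OF homeomorphic_point_ray]
    by (rule homeomorphic_space_sym[THEN iffD1])
next
  fix T :: "'t set" and r
  assume T: "pruned_tree T r \<and> ray_space T r homeomorphic_space X"
  then obtain h where "homeomorphic_map (ray_space T r) X h"
    unfolding homeomorphic_space by blast
  with T interpret tree_of_space T r X h by unfold_locales simp_all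
  show "\<exists>\<sigma>\<in>winning_strategies X.
          order_isomorphic T r (succ_seqs (dom \<sigma>)) (ext_order (succ_seqs (dom \<sigma>)))"
  proof (rule bexI)
    show "tree_strategy \<in> winning_strategies X"
      using winning_tree_strategy by (simp add: winning_strategies_def)
  qed (rule order_isomorphic_S)
qed

end
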